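(* Let $G$ be a finite simple connected walk-regular graph with diameter $D$, and let $h$ be an integer with $0\le h\le D$. The following statements are equivalent: (a) $G$ is $h$-punctually walk-regular. (b) $G$ is $h$-punctually spectrum-regular. (c) $G$ is $h$-punctually isospectral.
   Context: $\partial(u,v)$ denotes the distance between vertices $u,v$, and $\operatorname{sp}$ denotes the spectrum (eigenvalues with multiplicities) of the adjacency matrix of a graph or pseudograph (a graph possibly with loops and multiple edges). Let $A=(a_{xy})$ be the adjacency matrix of $G$, with distinct eigenvalues $\lambda_0>\lambda_1>\cdots>\lambda_d$, and let $E_i$ be the matrix of the orthogonal projection onto the eigenspace $\ker(\lambda_i I-A)$. $G$ is walk-regular if for every $\ell\ge 0$ the number $(A^\ell)_{uu}$ does not depend on the vertex $u$. For $0\le h\le D$: - $G$ is $h$-punctually walk-regular if for every $\ell\ge 0$ the number $(A^\ell)_{uv}$ of walks of length $\ell$ between $u$ and $v$ is the same for all pairs of vertices $u,v$ with $\partial(u,v)=h$. - $G$ is $h$-punctually spectrum-regular if for every $i=0,1,\dots,d$ the entry $(E_i)_{uv}$ is the same for all pairs of vertices $u,v$ with $\partial(u,v)=h$. Joint perturbations, for distinct vertices $u,v$: $G\pm uv$ is obtained from $G$ by flipping $uv$ (deleting the edge $uv$ if $u,v$ are adjacent, adding it otherwise). $G_{u+v}$ is the pseudograph obtained by amalgamating $u$ and $v$ into one new vertex $u+v$: adjacencies among other vertices are unchanged, the adjacency-matrix entry for $u+v$ and another vertex $x$ is $a_{ux}+a_{vx}$, and the diagonal entry at $u+v$ is $a_{uv}$.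 $G+u\bar u v$ is obtained by adding a new vertex $\bar u$ adjacent exactly to $u$ and $v$. For $1\le h\le D$, $G$ is $h$-punctually isospectral if, for all pairs of vertices $u,v$ and $w,z$ with $\partial(u,v)=\partial(w,z)=h$, at least one of the following holds: $\operatorname{sp}(G\pm uv)=\operatorname{sp}(G\pm wz)$; $\operatorname{sp} G_{u+v}=\operatorname{sp} G_{w+z}$; $\operatorname{sp}(G+u\bar u v)=\operatorname{sp}(G+w\bar w z)$. For $h=0$ (so $u=v$ and $w=z$), flipping $uu$ means adding a loop at $u$, and $G$ is $0$-punctually isospectral if $\operatorname{sp}(G+uu)=\operatorname{sp}(G+ww)$ for all vertices $u,w$, where $G+uu$ has adjacency matrix $A$ with the $uu$-entry changed to $1$. *)

theory Defs
  imports
    "Graph_Theory.Graph_Theory"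
    "Jordan_Normal_Form.Spectral_Radius"
    "Jordan_Normal_Form.Matrix_Kernel"
    "HOL-Library.Countable_Set"
begin

text \<open>
  A finite simple graph is a \<^locale>\<open>pair_graph\<close>. A pseudograph is given by its vertex set and
  its adjacency function; a loop contributes 1 to the diagonal entry.
\<close>

type_synonym 'b pseudograph = "'b set \<times> ('b \<Rightarrow> 'b \<Rightarrow> nat)"

text \<open>
  Rows and columns are ordered by the enumeration \<^const>\<open>to_nat_on\<close> of the vertex set, with
  inverse \<^const>\<open>from_nat_into\<close>. The entry belonging to vertices u, v is read off by \<open>entry\<close>.
\<close>

definition adj_mat :: "'b pseudograph \<Rightarrow> real mat" where
  "adj_mat = (\<lambda>(V, a). mat (card V) (card V)
     (\<lambda>(i, j). real (a (from_nat_into V i) (from_nat_into V j))))"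

definition entry :: "'b set \<Rightarrow> real mat \<Rightarrow> 'b \<Rightarrow> 'b \<Rightarrow> real" where
  "entry V M u v = M $$ (to_nat_on V u, to_nat_on V v)"

text \<open>
  The multiset of real roots of the characteristic polynomial contains all eigenvalues, because
  the adjacency matrices considered here are symmetric.
\<close>

definition sp :: "'b pseudograph \<Rightarrow> real multiset" where
  "sp H = proots (char_poly (adj_mat H))"

definition adj :: "'a pair_pre_digraph \<Rightarrow> 'a \<Rightarrow> 'a \<Rightarrow> nat" where
  "adj G x y = of_bool ((x, y) \<in> parcs G)"

definition gmat :: "'a pair_pre_digraph \<Rightarrow> real mat" where
  "gmat G = adj_mat (pverts G, adj G)"

definition gdist :: "'a pair_pre_digraph \<Rightarrow> 'a \<Rightarrow> 'a \<Rightarrow> ereal" where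
  "gdist G u v = wf_digraph.\<mu> (with_proj G) (\<lambda>_. 1) u v"

definition diameter :: "'a pair_pre_digraph \<Rightarrow> ereal" where
  "diameter G = (SUP u\<in>pverts G. SUP v\<in>pverts G. gdist G u v)"

definition walk_regular :: "'a pair_pre_digraph \<Rightarrow> bool" where
  "walk_regular G \<longleftrightarrow> (\<forall>l. \<forall>u\<in>pverts G. \<forall>v\<in>pverts G.
     entry (pverts G) (gmat G ^\<^sub>m l) u u = entry (pverts G) (gmat G ^\<^sub>m l) v v)"

definition punctually_walk_regular :: "nat \<Rightarrow> 'a pair_pre_digraph \<Rightarrow> bool" where
  "punctually_walk_regular h G \<longleftrightarrow>
     (\<forall>l. \<forall>u\<in>pverts G. \<forall>v\<in>pverts G. \<forall>w\<in>pverts G. \<forall>z\<in>pverts G.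
        gdist G u v = ereal (real h) \<longrightarrow> gdist G w z = ereal (real h) \<longrightarrow>
        entry (pverts G) (gmat G ^\<^sub>m l) u v = entry (pverts G) (gmat G ^\<^sub>m l) w z)"

definition orth_proj_mat :: "nat \<Rightarrow> real vec set \<Rightarrow> real mat" where
  "orth_proj_mat n W = (THE E. E \<in> carrier_mat n n \<and>
     (\<forall>x\<in>carrier_vec n. E *\<^sub>v x \<in> W \<and> (\<forall>w\<in>W. (x - E *\<^sub>v x) \<bullet> w = 0)))"

definition eigenproj :: "real mat \<Rightarrow> real \<Rightarrow> real mat" where
  "eigenproj A t = orth_proj_mat (dim_row A) (mat_kernel (t \<cdot>\<^sub>m 1\<^sub>m (dim_row A) - A))"

definition punctually_spectrum_regular :: "nat \<Rightarrow> 'a pair_pre_digraph \<Rightarrow> bool" where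
  "punctually_spectrum_regular h G \<longleftrightarrow>
     (\<forall>t\<in>spectrum (gmat G). \<forall>u\<in>pverts G. \<forall>v\<in>pverts G. \<forall>w\<in>pverts G. \<forall>z\<in>pverts G.
        gdist G u v = ereal (real h) \<longrightarrow> gdist G w z = ereal (real h) \<longrightarrow>
        entry (pverts G) (eigenproj (gmat G) t) u v = entry (pverts G) (eigenproj (gmat G) t) w z)"

text \<open>For u = v, \<open>flip\<close> adds a loop at u. In \<open>amalgamate\<close> and \<open>add_path\<close>, the new vertex is
  \<^const>\<open>None\<close> and an old vertex x is \<^term>\<open>Some x\<close>.\<close>

definition flip :: "'a pair_pre_digraph \<Rightarrow> 'a \<Rightarrow> 'a \<Rightarrow> 'a pseudograph" where
  "flip G u v = (pverts G,
     (\<lambda>x y. if {x, y} = {u, v} then 1 - adj G x y else adj G x y))"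

definition amalgamate :: "'a pair_pre_digraph \<Rightarrow> 'a \<Rightarrow> 'a \<Rightarrow> 'a option pseudograph" where
  "amalgamate G u v = (insert None (Some ` (pverts G - {u, v})),
     (\<lambda>x y. case (x, y) of
         (None, None) \<Rightarrow> adj G u v
       | (None, Some y') \<Rightarrow> adj G u y' + adj G v y'
       | (Some x', None) \<Rightarrow> adj G u x' + adj G v x'
       | (Some x', Some y') \<Rightarrow> adj G x' y'))"

definition add_path :: "'a pair_pre_digraph \<Rightarrow> 'a \<Rightarrow> 'a \<Rightarrow> 'a option pseudograph" where
  "add_path G u v = (insert None (Some ` pverts G),
     (\<lambda>x y. case (x, y) of
         (None, None) \<Rightarrow> 0
       | (None, Some y') \<Rightarrow> of_bool (y' \<in> {u, v})
       | (Some x', None) \<Rightarrow> of_bool (x' \<in> {u, v})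
       | (Some x', Some y') \<Rightarrow> adj G x' y'))"

definition punctually_isospectral :: "nat \<Rightarrow> 'a pair_pre_digraph \<Rightarrow> bool" where
  "punctually_isospectral h G \<longleftrightarrow>
     (if h = 0 then \<forall>u\<in>pverts G. \<forall>w\<in>pverts G. sp (flip G u u) = sp (flip G w w)
      else \<forall>u\<in>pverts G. \<forall>v\<in>pverts G. \<forall>w\<in>pverts G. \<forall>z\<in>pverts G.
        gdist G u v = ereal (real h) \<longrightarrow> gdist G w z = ereal (real h) \<longrightarrow>
        sp (flip G u v) = sp (flip G w z) \<or>
        sp (amalgamate G u v) = sp (amalgamate G w z) \<or>
        sp (add_path G u v) = sp (add_path G w z))"

end

theory Submission
  imports Defs "HOL-Computational_Algebra.Polynomial_FPS"
begin

text \<open>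
  Let W(X) be the inverse of I - XA over the real formal power series; its entries generate the
  numbers of walks. For a real symmetric A = sum of t E(t), the numbers (A^l)(u,v) for all l and
  the numbers (E(t))(u,v) for all t determine each other: A^l is the sum of the t^l E(t), and
  conversely each E(t) is a polynomial in A.

  For the isospectrality, order the vertices so that u and v come first and take Schur complements
  with respect to the remaining block N of I - XA. The 2 x 2 complement S is the inverse of the
  block of W with rows (r,t), (t,r), where r = W(u,u) = W(v,v) by walk-regularity and
  t = W(u,v). All three perturbations change S only, in an explicit way, so the determinants of
  the perturbed matrices are explicit functions of r, t, the adjacency of u and v, and
  det (I - XA). Comparing them for two pairs of vertices recovers t in each of the three cases.
\<close>

section \<open>Real symmetric matrices\<close>

text \<open>Power series are used because the block N has to be inverted. At a fixed real x, x I - A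
  may lose invertibility when u and v are deleted, whereas I - XA and all its principal blocks have
  constant term I and are inverted by their own walk series. With \<open>\<delta>\<close> = det N
  and \<open>\<phi>\<close> = det (I - XA) = \<open>\<delta>\<close> det S, the relation S
  [[r,t],[t,r]] = I gives \<open>\<delta>\<close> = \<open>\<phi>\<close> (r^2 - t^2) and
  \<open>\<delta>\<close> S = \<open>\<phi>\<close> [[r,-t],[-t,r]]. Multiplying by
  \<open>\<delta>\<close> thus removes all denominators, and every perturbed determinant is
  \<open>\<phi>\<close> times a polynomial in r, t, X and the adjacency c of u and v. Two pairs at
  the same distance h share r by walk-regularity, and share c because c = 1 exactly when h = 1. The
  polynomial may still be quadratic in t, so a second solution has to be excluded. It would force 2
  to equal a series with constant term 0, since walks between distinct vertices have positive
  length. Spectra turn into determinants only because all eigenvalues are real and the compared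
  graphs have equally many vertices.\<close>

text \<open>For an eigenvector v, the Hermitian form v* A v equals c |v|^2; it is its own conjugate
  because A is real and symmetric, and |v|^2 is nonzero.\<close>

lemma symmetric_real_eigenvalue_real:
  fixes A :: "real mat"
  assumes A: "A \<in> carrier_mat n n" and sym: "transpose_mat A = A"
    and root: "poly (char_poly (map_mat complex_of_real A)) c = 0"
  shows "c \<in> \<real>"
proof -
  let ?A = "map_mat complex_of_real A"
  have cA: "?A \<in> carrier_mat n n" using A by simp
  have "eigenvalue ?A c" using eigenvalue_root_char_poly[OF cA] root by simp
  then obtain v where v: "v \<in> carrier_vec n" "v \<noteq> 0\<^sub>v n" "?A *\<^sub>v v = c \<cdot>\<^sub>v v"
    using A unfolding eigenvalue_def eigenvector_def by auto
  have Asym: "A $$ (i,j) = A $$ (j,i)" if "i < n" "j < n" for i j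
    using arg_cong[OF sym, of "\<lambda>M. M $$ (i,j)"] that A by auto
  have ev: "(\<Sum>j<n. complex_of_real (A $$ (i,j)) * v $ j) = c * v $ i" if "i < n" for i
  proof -
    have "(?A *\<^sub>v v) $ i = (\<Sum>j<n. complex_of_real (A $$ (i,j)) * v $ j)"
      using A v(1) that by (auto simp: scalar_prod_def lessThan_atLeast0 intro!: sum.cong)
    with v that show ?thesis by simp
  qed
  define S where "S = (\<Sum>i<n. \<Sum>j<n. cnj (v $ i) * complex_of_real (A $$ (i,j)) * v $ j)"
  define N where "N = (\<Sum>i<n. (cmod (v $ i))\<^sup>2)"
  have "S = (\<Sum>i<n. cnj (v $ i) * (c * v $ i))"
    unfolding S_def by (intro sum.cong) (auto simp: ev[symmetric] sum_distrib_left mult.assoc)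
  also have "\<dots> = c * of_real N"
    unfolding N_def of_real_sum sum_distrib_left
    by (intro sum.cong) (auto simp: complex_norm_square simp flip: of_real_power)
  finally have SN: "S = c * of_real N" .
  have "cnj S = (\<Sum>i<n. \<Sum>j<n. cnj (v $ j) * complex_of_real (A $$ (j,i)) * v $ i)"
    unfolding S_def using Asym by (auto simp: mult_ac intro!: sum.cong)
  also have "\<dots> = S" unfolding S_def by (rule sum.swap)
  finally have "S \<in> \<real>" by (simp add: Reals_cnj_iff)
  moreover have "N \<noteq> 0"
  proof
    assume "N = 0"
    then have "\<forall>i<n. v $ i = 0"
      unfolding N_def by (subst (asm) sum_nonneg_eq_0_iff) auto
    then have "v = 0\<^sub>v n" using v(1) by auto
    with v(2) show False by simp
  qed
  ultimately show "c \<in> \<real>"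
    using SN by (metis Reals_divide Reals_of_real nonzero_mult_div_cancel_right of_real_eq_0_iff)
qed

text \<open>Induction on the degree: a complex root exists, is real by hypothesis and splits off.
  The hypothesis passes to the cofactor, whose complex roots are roots of \<open>p\<close>.\<close>

lemma real_poly_splits:
  fixes p :: "real poly"
  assumes "lead_coeff p = 1"
    and "\<And>c. poly (map_poly complex_of_real p) c = 0 \<Longrightarrow> c \<in> \<real>"
  shows "\<exists>as. p = (\<Prod>a\<leftarrow>as. [:- a, 1:])"
  using assms
proof (induction "degree p" arbitrary: p)
  case 0
  then have "p = 1" by (metis degree_0_id one_pCons)
  then show ?case by (intro exI[of _ "[]"]) simp
next
  case (Suc k)
  have "degree (map_poly complex_of_real p) \<noteq> 0" using Suc(2) by simp
  then have "\<not> constant (poly (map_poly complex_of_real p))"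
    by (simp add: constant_degree)
  then obtain c where c: "poly (map_poly complex_of_real p) c = 0"
    using fundamental_theorem_of_algebra by blast
  then obtain r where r: "c = of_real r" using Suc.prems(2) Reals_cases by metis
  have "poly p r = 0" using c unfolding r by simp
  then obtain q where q: "p = [:- r, 1:] * q"
    using poly_eq_0_iff_dvd by (metis dvdE)
  have q0: "q \<noteq> 0" using Suc(2) q by auto
  have "degree p = 1 + degree q" unfolding q using q0 by (subst degree_mult_eq) auto
  then have "k = degree q" using Suc(2) by simp
  moreover have "lead_coeff q = 1" using Suc(3) unfolding q by (simp add: lead_coeff_mult del: mult_pCons_left)
  moreover interpret poly_hom: map_poly_comm_semiring_hom complex_of_real ..
  have "c \<in> \<real>" if "poly (map_poly complex_of_real q) c = 0" for c
    using that Suc(4)[of c] unfolding q by (simp add: poly_hom.hom_mult del: mult_pCons_left)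
  ultimately obtain as where "q = (\<Prod>a\<leftarrow>as. [:- a, 1:])" using Suc(1) by blast
  then have "p = (\<Prod>a\<leftarrow>r # as. [:- a, 1:])" unfolding q by simp
  then show ?case by blast
qed

text \<open>Used twice: for the existence of a Jordan form over the reals, and for recovering the
  characteristic polynomial from its real roots.\<close>

lemma symmetric_char_poly_splits:
  fixes A :: "real mat"
  assumes A: "A \<in> carrier_mat n n" and sym: "transpose_mat A = A"
  shows "\<exists>as. char_poly A = (\<Prod>a\<leftarrow>as. [:- a, 1:])"
proof (rule real_poly_splits)
  show "lead_coeff (char_poly A) = 1" using degree_monic_char_poly[OF A] by simp
  fix c assume "poly (map_poly complex_of_real (char_poly A)) c = 0"
  then show "c \<in> \<real>"
    using symmetric_real_eigenvalue_real[OF A sym] of_real_hom.char_poly_hom[OF A] by metis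
qed

text \<open>A monic product of linear factors is rebuilt from its multiset of roots. Without
  splitting, \<open>proots\<close> would forget the quadratic factors with no real root.\<close>

lemma symmetric_proots_char_poly_eq_iff:
  fixes A B :: "real mat"
  assumes "A \<in> carrier_mat n n" "transpose_mat A = A"
    and "B \<in> carrier_mat m m" "transpose_mat B = B"
  shows "proots (char_poly A) = proots (char_poly B) \<longleftrightarrow> char_poly A = char_poly B"
proof
  have *: "char_poly C = (\<Prod>a\<in>#proots (char_poly C). [:- a, 1:])"
    if "C \<in> carrier_mat k k" "transpose_mat C = C" for C :: "real mat" and k
  proof -
    obtain as where as: "char_poly C = (\<Prod>a\<leftarrow>as. [:- a, 1:])"
      using symmetric_char_poly_splits \<open>C \<in> carrier_mat k k\<close> \<open>transpose_mat C = C\<close> by blast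
    have "proots (\<Prod>a\<leftarrow>as. [:- a, 1:]) = mset as"
    proof (induction as)
      case (Cons a as)
      have "(\<Prod>a\<leftarrow>as. [:- a, 1:]) \<noteq> 0" by auto
      then show ?case using Cons by (simp add: proots_mult del: mult_pCons_left)
    qed simp
    with as show ?thesis by (simp flip: prod_mset_prod_list)
  qed
  show "char_poly A = char_poly B" if "proots (char_poly A) = proots (char_poly B)"
    using *[of A] *[of B] assms that by metis
qed auto

text \<open>Puts the block structure into terms of single entries, so that the diagonalization
  argument can speak of columns and need not mention blocks.\<close>

lemma jordan_matrix_off_diagonal:
  fixes n_as :: "(nat \<times> 'a :: semiring_1) list"
  assumes "i < sum_list (map fst n_as)" "j < sum_list (map fst n_as)" "i \<noteq> j"
    and "jordan_matrix n_as $$ (i,j) \<noteq> 0"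
  shows "j = Suc i \<and> jordan_matrix n_as $$ (i,j) = 1 \<and>
    jordan_matrix n_as $$ (i,i) = jordan_matrix n_as $$ (j,j)"
  using assms
proof (induction n_as arbitrary: i j)
  case (Cons na n_as)
  obtain n a where na: "na = (n,a)" by force
  show ?case
  proof (cases "i < n \<or> j < n")
    case True
    then show ?thesis using Cons.prems unfolding na jordan_matrix_Cons
      by (auto split: if_splits)
  next
    case False
    then obtain i' j' where "i = n + i'" "j = n + j'" by (metis le_Suc_ex not_le)
    then show ?thesis using Cons.prems Cons.IH[of i' j'] unfolding na jordan_matrix_Cons
      by (auto split: if_splits)
  qed
qed simp

lemma mult_mat_entry:
  fixes A :: "'a :: semiring_0 mat"
  assumes "A \<in> carrier_mat n k" "B \<in> carrier_mat k m" "i < n" "j < m"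
  shows "(A * B) $$ (i,j) = (\<Sum>l<k. A $$ (i,l) * B $$ (l,j))"
  using assms by (auto simp: scalar_prod_def lessThan_atLeast0 intro!: sum.cong)

text \<open>A Jordan block of size at least two would give vectors p, q with (A - c) q = p and
  (A - c) p = 0, hence p . p = p . (A - c) q = (A - c) p . q = 0.\<close>
lemma symmetric_real_diagonalizable:
  fixes A :: "real mat"
  assumes A: "A \<in> carrier_mat n n" and sym: "transpose_mat A = A"
  obtains P Q d where "P \<in> carrier_mat n n" "Q \<in> carrier_mat n n" "P * Q = 1\<^sub>m n" "Q * P = 1\<^sub>m n"
    "\<And>i k. i < n \<Longrightarrow> k < n \<Longrightarrow> (A * P) $$ (i,k) = d k * P $$ (i,k)"
proof -
  obtain as where "char_poly A = (\<Prod>a\<leftarrow>as. [:- a, 1:])"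
    using symmetric_char_poly_splits[OF A sym] by blast
  then obtain n_as where "jordan_nf A n_as" using jordan_nf_exists[OF A] by blast
  then obtain P Q where wit: "similar_mat_wit A (jordan_matrix n_as) P Q"
    unfolding jordan_nf_def similar_mat_def by blast
  define J where "J = jordan_matrix n_as"
  have car: "P \<in> carrier_mat n n" "Q \<in> carrier_mat n n" "J \<in> carrier_mat n n"
    and PQ: "P * Q = 1\<^sub>m n" "Q * P = 1\<^sub>m n" and AJ: "A = P * J * Q"
    using wit A unfolding similar_mat_wit_def J_def Let_def by auto
  have dimJ: "sum_list (map fst n_as) = n"
    using car(3) jordan_matrix_dim(1)[of n_as] unfolding J_def by auto
  have AP: "A * P = P * J"
  proof -
    have "A * P = P * J * (Q * P)" unfolding AJ using car by (simp add: assoc_mult_mat[of _ n n _ n _ n])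
    also have "\<dots> = P * J" unfolding PQ using car by simp
    finally show ?thesis .
  qed
  have APe: "(A * P) $$ (i,k) = (\<Sum>l<n. P $$ (i,l) * J $$ (l,k))" if "i < n" "k < n" for i k
    unfolding AP using mult_mat_entry[OF car(1) car(3) that] .
  have offd: "j = Suc i \<and> J $$ (i,j) = 1 \<and> J $$ (i,i) = J $$ (j,j)"
    if "i < n" "j < n" "i \<noteq> j" "J $$ (i,j) \<noteq> 0" for i j
    using jordan_matrix_off_diagonal[of i n_as j] that dimJ unfolding J_def by auto
  have Asym: "A $$ (i,j) = A $$ (j,i)" if "i < n" "j < n" for i j
    using arg_cong[OF sym, of "\<lambda>M. M $$ (i,j)"] that A by auto
  have diagJ: "J $$ (i,j) = 0" if ij: "i < n" "j < n" "i \<noteq> j" for i j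
  proof (rule ccontr)
    define bad where "bad k \<longleftrightarrow> Suc k < n \<and> J $$ (k, Suc k) \<noteq> 0" for k
    assume "J $$ (i,j) \<noteq> 0"
    then have "bad i" using offd[OF ij] ij unfolding bad_def by auto
    \<comment> \<open>Minimality of \<open>k\<close> leaves column \<open>k\<close> of
      \<open>J\<close> without an entry above the diagonal, so column \<open>k\<close> of
      \<open>P\<close> is a genuine eigenvector and the next column a generalized one.\<close>
    define k where "k = (LEAST k. bad k)"
    have k: "bad k" and least: "\<And>l. l < k \<Longrightarrow> \<not> bad l"
      unfolding k_def using \<open>bad i\<close> by (auto intro: LeastI dest: not_less_Least)
    have kn: "Suc k < n" and Jk: "J $$ (k, Suc k) = 1" "J $$ (k,k) = J $$ (Suc k, Suc k)"
      using k offd[of k "Suc k"] unfolding bad_def by auto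
    define c where "c = J $$ (k,k)"
    define p where "p i = P $$ (i,k)" for i
    define q where "q i = P $$ (i,Suc k)" for i
    have col0: "J $$ (l,k) = 0" if "l < n" "l \<noteq> k" for l
      using offd[of l k] least[of l] that kn unfolding bad_def by (cases "J $$ (l,k) = 0") auto
    have col1: "J $$ (l,Suc k) = 0" if "l < n" "l \<noteq> k" "l \<noteq> Suc k" for l
      using offd[of l "Suc k"] that kn by (cases "J $$ (l,Suc k) = 0") auto
    have Ap: "(\<Sum>l<n. A $$ (i,l) * p l) = c * p i" if "i < n" for i
    proof -
      have "(\<Sum>l<n. A $$ (i,l) * p l) = (\<Sum>l<n. P $$ (i,l) * J $$ (l,k))"
        using APe[of i k] mult_mat_entry[OF A car(1), of i k] that kn by (simp add: p_def)
      also have "\<dots> = (\<Sum>l\<in>{k}. P $$ (i,l) * J $$ (l,k))"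
        by (rule sum.mono_neutral_right) (use kn col0 in auto)
      finally show ?thesis by (simp add: c_def p_def)
    qed
    have Aq: "(\<Sum>l<n. A $$ (i,l) * q l) = p i + c * q i" if "i < n" for i
    proof -
      have "(\<Sum>l<n. A $$ (i,l) * q l) = (\<Sum>l<n. P $$ (i,l) * J $$ (l,Suc k))"
        using APe[of i "Suc k"] mult_mat_entry[OF A car(1), of i "Suc k"] that kn by (simp add: q_def)
      also have "\<dots> = (\<Sum>l\<in>{k,Suc k}. P $$ (i,l) * J $$ (l,Suc k))"
        by (rule sum.mono_neutral_right) (use kn col1 in auto)
      finally show ?thesis using Jk by (simp add: c_def p_def q_def)
    qed
    have "(\<Sum>i<n. p i * (p i + c * q i)) = (\<Sum>i<n. \<Sum>l<n. p i * A $$ (i,l) * q l)"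
      by (intro sum.cong) (auto simp: Aq[symmetric] sum_distrib_left mult.assoc)
    also have "\<dots> = (\<Sum>l<n. \<Sum>i<n. p i * A $$ (i,l) * q l)" by (rule sum.swap)
    also have "\<dots> = (\<Sum>l<n. (c * p l) * q l)"
    proof (intro sum.cong refl)
      fix l assume l: "l \<in> {..<n}"
      show "(\<Sum>i<n. p i * A $$ (i,l) * q l) = c * p l * q l"
        using l Asym by (auto simp: Ap[symmetric] sum_distrib_left sum_distrib_right mult_ac intro!: sum.cong)
    qed
    finally have "(\<Sum>i<n. p i * p i) = 0"
      by (simp add: algebra_simps sum.distrib)
    then have p0: "\<forall>i<n. p i = 0"
      by (subst (asm) sum_nonneg_eq_0_iff) auto
    have "(Q * P) $$ (k,k) = (\<Sum>l<n. Q $$ (k,l) * p l)"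
      unfolding p_def using mult_mat_entry[OF car(2) car(1)] kn by auto
    also have "\<dots> = 0" using p0 by simp
    finally show False unfolding PQ using kn by simp
  qed
  have "(A * P) $$ (i,k) = J $$ (k,k) * P $$ (i,k)" if "i < n" "k < n" for i k
  proof -
    have "(A * P) $$ (i,k) = (\<Sum>l\<in>{k}. P $$ (i,l) * J $$ (l,k))"
      unfolding APe[OF that] by (rule sum.mono_neutral_right) (use that diagJ in auto)
    then show ?thesis by simp
  qed
  then show ?thesis by (rule that[OF car(1,2) PQ])
qed

section \<open>Spectral projections and powers\<close>

text \<open>Newton interpolation: a multiple of the polynomial vanishing on \<open>S\<close>
  corrects the value at the new point and disturbs no old one. It makes every function on a finite
  spectrum a polynomial.\<close>

lemma poly_interpolation_exists:
  fixes f :: "'a :: field \<Rightarrow> 'a"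
  assumes "finite S"
  shows "\<exists>p. \<forall>x\<in>S. poly p x = f x"
  using assms
proof induction
  case (insert a S)
  then obtain p where p: "\<forall>x\<in>S. poly p x = f x" by blast
  define m where "m = (\<Prod>s\<in>S. [:- s, 1:])"
  have "poly m a \<noteq> 0" "\<forall>x\<in>S. poly m x = 0"
    using insert(1,2) unfolding m_def poly_prod by (auto simp: prod_zero_iff)
  then have "\<forall>x\<in>insert a S. poly (p + [:(f a - poly p a) / poly m a:] * m) x = f x"
    using p by auto
  then show ?case by blast
qed simp

lemma eq_mat_by_mult_vec:
  fixes A B :: "'a :: comm_semiring_1 mat"
  assumes "A \<in> carrier_mat n m" "B \<in> carrier_mat n m"
    and "\<And>x. x \<in> carrier_vec m \<Longrightarrow> A *\<^sub>v x = B *\<^sub>v x"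
  shows "A = B"
proof (rule eq_matI)
  fix i j assume ij: "i < dim_row B" "j < dim_col B"
  have "(A *\<^sub>v unit_vec m j) $ i = (B *\<^sub>v unit_vec m j) $ i" by (simp add: assms(3))
  then show "A $$ (i,j) = B $$ (i,j)" using ij assms(1,2) by simp
qed (use assms in auto)

text \<open>Resolves the definite description: for two candidates, the difference of the images of a
  vector lies in \<open>W\<close> and is orthogonal to \<open>W\<close>, hence to itself.\<close>

lemma orth_proj_mat_eqI:
  assumes E: "E \<in> carrier_mat n n"
    and proj: "\<And>x. x \<in> carrier_vec n \<Longrightarrow> E *\<^sub>v x \<in> W"
      "\<And>x w. x \<in> carrier_vec n \<Longrightarrow> w \<in> W \<Longrightarrow> (x - E *\<^sub>v x) \<bullet> w = 0"
    and W: "W \<subseteq> carrier_vec n" "\<And>v w. v \<in> W \<Longrightarrow> w \<in> W \<Longrightarrow> v - w \<in> W"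
  shows "orth_proj_mat n W = E"
  unfolding orth_proj_mat_def
proof (rule the_equality)
  fix F assume F: "F \<in> carrier_mat n n \<and>
    (\<forall>x\<in>carrier_vec n. F *\<^sub>v x \<in> W \<and> (\<forall>w\<in>W. (x - F *\<^sub>v x) \<bullet> w = 0))"
  show "F = E"
  proof (rule eq_mat_by_mult_vec)
    fix x :: "real vec" assume x: "x \<in> carrier_vec n"
    define y where "y = F *\<^sub>v x - E *\<^sub>v x"
    have c: "F *\<^sub>v x \<in> carrier_vec n" "E *\<^sub>v x \<in> carrier_vec n" using F E x by auto
    have y: "y \<in> W" "y \<in> carrier_vec n" unfolding y_def using F proj x W by auto
    have "y = (x - E *\<^sub>v x) - (x - F *\<^sub>v x)" unfolding y_def
      by (rule eq_vecI) (use E F x in auto)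
    then have "y \<bullet> y = ((x - E *\<^sub>v x) - (x - F *\<^sub>v x)) \<bullet> y" by simp
    also have "\<dots> = (x - E *\<^sub>v x) \<bullet> y - (x - F *\<^sub>v x) \<bullet> y"
      by (rule minus_scalar_prod_distrib) (use c x y in auto)
    also have "\<dots> = 0" using F proj x y by simp
    finally have "y = 0\<^sub>v n" using conjugate_square_eq_0_vec[of y n] y(2) by simp
    then have y0: "y $ i = 0" if "i < n" for i using that by simp
    show "F *\<^sub>v x = E *\<^sub>v x"
      by (rule eq_vecI) (use y0 c E F in \<open>auto simp: y_def\<close>)
  qed (use F E in auto)
qed (use assms in auto)

lemma smult_mat_mult_vec:
  fixes A :: "'a :: comm_semiring_0 mat"
  assumes "A \<in> carrier_mat n m" "v \<in> carrier_vec m"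
  shows "(k \<cdot>\<^sub>m A) *\<^sub>v v = k \<cdot>\<^sub>v (A *\<^sub>v v)"
  by (rule eq_vecI) (use assms in \<open>auto simp: scalar_prod_def sum_distrib_left mult_ac\<close>)

lemma pow_mat_mult_vec_eigen:
  fixes A :: "'a :: field mat"
  assumes A: "A \<in> carrier_mat n n" and v: "v \<in> carrier_vec n" and ev: "A *\<^sub>v v = t \<cdot>\<^sub>v v"
  shows "(A ^\<^sub>m l) *\<^sub>v v = t ^ l \<cdot>\<^sub>v v"
proof (induction l)
  case (Suc l)
  have "A ^\<^sub>m Suc l *\<^sub>v v = A ^\<^sub>m l *\<^sub>v (A *\<^sub>v v)"
    using A v by (simp add: assoc_mult_mat_vec[of _ n n _ n])
  also have "\<dots> = t \<cdot>\<^sub>v (t ^ l \<cdot>\<^sub>v v)"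
    unfolding ev using Suc A v
    by (simp add: mult_mat_vec[of _ n n] pow_carrier_mat smult_smult_assoc mult.commute)
  finally show ?case by (simp add: smult_smult_assoc)
qed (use A v in simp)

lemma pow_mat_Suc_left:
  fixes A :: "'a :: semiring_1 mat"
  assumes "A \<in> carrier_mat n n"
  shows "A ^\<^sub>m Suc l = A * A ^\<^sub>m l"
  using assms by (induction l) (simp_all add: assoc_mult_mat[of _ n n _ n _ n])

lemma transpose_pow_mat:
  fixes A :: "'a :: comm_semiring_1 mat"
  assumes A: "A \<in> carrier_mat n n" and sym: "transpose_mat A = A"
  shows "transpose_mat (A ^\<^sub>m l) = A ^\<^sub>m l"
proof (induction l)
  case (Suc l)
  have "transpose_mat (A ^\<^sub>m Suc l) = A * A ^\<^sub>m l"
    using Suc A sym by (simp add: transpose_mult[of _ n n _ n])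
  then show ?case unfolding pow_mat_Suc_left[OF A] .
qed (use A in simp)

locale diagonalized =
  fixes n :: nat and A P Q :: "real mat" and d :: "nat \<Rightarrow> real"
  assumes A: "A \<in> carrier_mat n n" and sym: "transpose_mat A = A"
    and P: "P \<in> carrier_mat n n" and Q: "Q \<in> carrier_mat n n"
    and PQ: "P * Q = 1\<^sub>m n" and QP: "Q * P = 1\<^sub>m n"
    and AP: "\<And>i k. i < n \<Longrightarrow> k < n \<Longrightarrow> (A * P) $$ (i,k) = d k * P $$ (i,k)"
begin

text \<open>The (i,j) entry of f(A).\<close>
definition fun_calc :: "(real \<Rightarrow> real) \<Rightarrow> nat \<Rightarrow> nat \<Rightarrow> real" where
  "fun_calc f i j = (\<Sum>k<n. f (d k) * P $$ (i,k) * Q $$ (k,j))"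

lemma mult_fun_calc:
  assumes "i < n"
  shows "(\<Sum>l<n. A $$ (i,l) * fun_calc f l j) = fun_calc (\<lambda>x. x * f x) i j"
proof -
  have "(\<Sum>l<n. A $$ (i,l) * fun_calc f l j)
      = (\<Sum>l<n. \<Sum>k<n. f (d k) * (A $$ (i,l) * P $$ (l,k)) * Q $$ (k,j))"
    unfolding fun_calc_def sum_distrib_left by (simp add: mult_ac)
  also have "\<dots> = (\<Sum>k<n. \<Sum>l<n. f (d k) * (A $$ (i,l) * P $$ (l,k)) * Q $$ (k,j))"
    by (rule sum.swap)
  also have "\<dots> = fun_calc (\<lambda>x. x * f x) i j"
    unfolding fun_calc_def
  proof (intro sum.cong refl)
    fix k assume k: "k \<in> {..<n}"
    have "(\<Sum>l<n. A $$ (i,l) * P $$ (l,k)) = d k * P $$ (i,k)"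
      using AP[of i k] mult_mat_entry[OF A P assms, of k] k assms by simp
    then have "f (d k) * (\<Sum>l<n. A $$ (i,l) * P $$ (l,k)) * Q $$ (k,j)
        = d k * f (d k) * P $$ (i,k) * Q $$ (k,j)" by (simp add: mult_ac)
    then show "(\<Sum>l<n. f (d k) * (A $$ (i,l) * P $$ (l,k)) * Q $$ (k,j))
        = d k * f (d k) * P $$ (i,k) * Q $$ (k,j)"
      by (simp add: sum_distrib_left sum_distrib_right)
  qed
  finally show ?thesis .
qed

lemma pow_mat_entry:
  assumes "i < n" "j < n"
  shows "(A ^\<^sub>m l) $$ (i,j) = fun_calc (\<lambda>x. x ^ l) i j"
  using assms
proof (induction l arbitrary: i)
  case 0
  have "(P * Q) $$ (i,j) = fun_calc (\<lambda>x. x ^ 0) i j"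
    unfolding mult_mat_entry[OF P Q 0] fun_calc_def by simp
  with A PQ show ?case by simp
next
  case (Suc l)
  have "(A ^\<^sub>m Suc l) $$ (i,j) = (\<Sum>k<n. A $$ (i,k) * (A ^\<^sub>m l) $$ (k,j))"
    unfolding pow_mat_Suc_left[OF A] using A Suc.prems by (intro mult_mat_entry) auto
  also have "\<dots> = (\<Sum>k<n. A $$ (i,k) * fun_calc (\<lambda>x. x ^ l) k j)"
    using Suc by (intro sum.cong) auto
  finally show ?case using mult_fun_calc Suc.prems by simp
qed

lemma fun_calc_poly:
  assumes "i < n" "j < n"
  shows "fun_calc (poly p) i j = (\<Sum>l\<le>degree p. coeff p l * (A ^\<^sub>m l) $$ (i,j))"
proof -
  have "(\<Sum>l\<le>degree p. coeff p l * (A ^\<^sub>m l) $$ (i,j))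
      = (\<Sum>l\<le>degree p. \<Sum>k<n. coeff p l * d k ^ l * P $$ (i,k) * Q $$ (k,j))"
    unfolding pow_mat_entry[OF assms] fun_calc_def sum_distrib_left by (simp add: mult_ac)
  also have "\<dots> = (\<Sum>k<n. \<Sum>l\<le>degree p. coeff p l * d k ^ l * P $$ (i,k) * Q $$ (k,j))"
    by (rule sum.swap)
  also have "\<dots> = fun_calc (poly p) i j"
    unfolding fun_calc_def poly_altdef by (simp add: sum_distrib_right)
  finally show ?thesis ..
qed

text \<open>The extra node \<open>t\<close> controls p also at a number that may not occur among the
  \<open>d k\<close>; this lets \<open>eigenproj_eq\<close> treat all t alike, eigenvalue or
  not.\<close>

lemma fun_calc_as_poly:
  obtains p where "\<And>i j. fun_calc f i j = fun_calc (poly p) i j" "poly p t = f t"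
proof -
  obtain p where p: "\<forall>x\<in>insert t (d ` {..<n}). poly p x = f x"
    using poly_interpolation_exists[of "insert t (d ` {..<n})" f] by auto
  then show ?thesis by (intro that[of p]) (auto simp: fun_calc_def)
qed

text \<open>\<open>P\<close> is not assumed orthogonal, so symmetry is invisible in the defining
  sum. It is inherited from the powers of \<open>A\<close>, of which f(A) is a linear
  combination.\<close>

lemma fun_calc_sym:
  assumes "i < n" "j < n"
  shows "fun_calc f i j = fun_calc f j i"
proof -
  obtain p where p: "\<And>i j. fun_calc f i j = fun_calc (poly p) i j"
    using fun_calc_as_poly by metis
  have "(A ^\<^sub>m l) $$ (i,j) = (A ^\<^sub>m l) $$ (j,i)" for l
    using arg_cong[OF transpose_pow_mat[OF A sym, of l], of "\<lambda>M. M $$ (i,j)"] assms A by auto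
  then show ?thesis unfolding p using fun_calc_poly assms by simp
qed

text \<open>Let E be the indicator of t applied to A. Its image lies in the kernel because x [x = t]
  = t [x = t]. It fixes the kernel because E = p(A) with p(t) = 1. With the symmetry of E this gives
  (x - E x) . w = x . w - x . E w = 0 for w in the kernel.\<close>

lemma eigenproj_eq: "eigenproj A t = mat n n (\<lambda>(i,j). fun_calc (\<lambda>x. of_bool (x = t)) i j)"
proof -
  let ?E = "mat n n (\<lambda>(i,j). fun_calc (\<lambda>x. of_bool (x = t)) i j)"
  let ?W = "mat_kernel (t \<cdot>\<^sub>m 1\<^sub>m n - A)"
  have dim: "dim_row A = n" using A by simp
  have W: "w \<in> ?W \<longleftrightarrow> w \<in> carrier_vec n \<and> A *\<^sub>v w = t \<cdot>\<^sub>v w" for w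
  proof -
    have "(t \<cdot>\<^sub>m 1\<^sub>m n - A) *\<^sub>v w = t \<cdot>\<^sub>v w - A *\<^sub>v w" if "w \<in> carrier_vec n"
      using that A by (subst minus_mult_distrib_mat_vec[of _ n n])
        (auto simp: smult_mat_mult_vec[of _ n n])
    moreover have "t \<cdot>\<^sub>v w - A *\<^sub>v w = 0\<^sub>v n \<longleftrightarrow> A *\<^sub>v w = t \<cdot>\<^sub>v w" if "w \<in> carrier_vec n"
      using that A by (auto simp: vec_eq_iff)
    moreover have "?W = {v \<in> carrier_vec n. (t \<cdot>\<^sub>m 1\<^sub>m n - A) *\<^sub>v v = 0\<^sub>v n}"
      by (subst mat_kernel[of _ n n]) (use A in auto)
    ultimately show ?thesis by fastforce
  qed
  have E_sym: "transpose_mat ?E = ?E" by (rule eq_matI) (auto simp: fun_calc_sym)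
  have AE: "A *\<^sub>v (?E *\<^sub>v x) = t \<cdot>\<^sub>v (?E *\<^sub>v x)" if x: "x \<in> carrier_vec n" for x
  proof -
    have "A * ?E = t \<cdot>\<^sub>m ?E"
    proof (rule eq_matI)
      fix i j assume "i < dim_row (t \<cdot>\<^sub>m ?E)" "j < dim_col (t \<cdot>\<^sub>m ?E)"
      then have ij: "i < n" "j < n" by auto
      have "(A * ?E) $$ (i,j) = (\<Sum>l<n. A $$ (i,l) * fun_calc (\<lambda>x. of_bool (x = t)) l j)"
        using mult_mat_entry[OF A _ ij, of ?E] ij by auto
      also have "\<dots> = (t \<cdot>\<^sub>m ?E) $$ (i,j)"
        unfolding mult_fun_calc[OF ij(1)] using ij
        by (auto simp: fun_calc_def sum_distrib_left intro!: sum.cong)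
      finally show "(A * ?E) $$ (i,j) = (t \<cdot>\<^sub>m ?E) $$ (i,j)" .
    qed (use A in auto)
    then show ?thesis using A x
      by (simp flip: assoc_mult_mat_vec[of _ n n _ n])
        (simp add: smult_mat_mult_vec[of _ n n])
  qed
  have Ew: "?E *\<^sub>v w = w" if w: "w \<in> ?W" for w
  proof (rule eq_vecI)
    fix i assume "i < dim_vec w"
    then have i: "i < n" and wc: "w \<in> carrier_vec n" and ev: "A *\<^sub>v w = t \<cdot>\<^sub>v w" using w W by auto
    obtain p where p: "\<And>i j. fun_calc (\<lambda>x. of_bool (x = t)) i j = fun_calc (poly p) i j" "poly p t = 1"
      using fun_calc_as_poly[of "\<lambda>x. of_bool (x = t)" t] by auto
    have "(?E *\<^sub>v w) $ i = (\<Sum>j<n. fun_calc (poly p) i j * w $ j)"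
      using i wc by (auto simp: scalar_prod_def lessThan_atLeast0 p(1) intro!: sum.cong)
    also have "\<dots> = (\<Sum>j<n. \<Sum>l\<le>degree p. coeff p l * ((A ^\<^sub>m l) $$ (i,j) * w $ j))"
      using i by (intro sum.cong) (auto simp: fun_calc_poly sum_distrib_left sum_distrib_right mult_ac)
    also have "\<dots> = (\<Sum>l\<le>degree p. \<Sum>j<n. coeff p l * ((A ^\<^sub>m l) $$ (i,j) * w $ j))"
      by (rule sum.swap)
    also have "\<dots> = (\<Sum>l\<le>degree p. coeff p l * ((A ^\<^sub>m l *\<^sub>v w) $ i))"
      using i wc A by (auto simp: scalar_prod_def lessThan_atLeast0 sum_distrib_left intro!: sum.cong)
    also have "\<dots> = poly p t * w $ i"
      unfolding pow_mat_mult_vec_eigen[OF A wc ev] poly_altdef using i wc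
      by (simp add: sum_distrib_left sum_distrib_right mult_ac)
    finally show "(?E *\<^sub>v w) $ i = w $ i" using p(2) by simp
  qed (use w W in auto)
  have "orth_proj_mat n ?W = ?E"
  proof (rule orth_proj_mat_eqI)
    fix x :: "real vec" assume x: "x \<in> carrier_vec n"
    then have cE: "?E *\<^sub>v x \<in> carrier_vec n" by (intro mult_mat_vec_carrier[of _ n n]) auto
    then show "?E *\<^sub>v x \<in> ?W" using AE[OF x] W by blast
    fix w assume w: "w \<in> ?W"
    then have wc: "w \<in> carrier_vec n" using W by blast
    have "(?E *\<^sub>v x) \<bullet> w = x \<bullet> (transpose_mat ?E *\<^sub>v w)"
      using transpose_vec_mult_scalar[of "transpose_mat ?E" n n w x] x wc cE
      by (simp add: comm_scalar_prod[of "?E *\<^sub>v x" n w] comm_scalar_prod[of x n] E_sym)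
    also have "\<dots> = x \<bullet> w" using E_sym Ew[OF w] by simp
    finally show "(x - ?E *\<^sub>v x) \<bullet> w = 0"
      using minus_scalar_prod_distrib[OF x cE wc] by simp
  next
    fix v w assume "v \<in> ?W" "w \<in> ?W"
    then have vw: "v \<in> carrier_vec n" "w \<in> carrier_vec n" "A *\<^sub>v v = t \<cdot>\<^sub>v v" "A *\<^sub>v w = t \<cdot>\<^sub>v w"
      unfolding W by auto
    have "A *\<^sub>v (v - w) = t \<cdot>\<^sub>v (v - w)"
      unfolding mult_minus_distrib_mat_vec[OF A vw(1,2)] vw(3,4)
      by (rule eq_vecI) (use vw(1,2) in \<open>auto simp: right_diff_distrib\<close>)
    then show "v - w \<in> ?W" unfolding W using vw by simp
  qed (use W in auto)
  then show ?thesis unfolding eigenproj_def dim .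
qed

text \<open>Column k of \<open>P\<close> is an eigenvector, nonzero because \<open>P\<close> is
  invertible. Spectrum-regularity speaks only about members of the spectrum, hence the need for
  this.\<close>

lemma d_in_spectrum:
  assumes "k < n"
  shows "d k \<in> spectrum A"
proof -
  have "A *\<^sub>v col P k = d k \<cdot>\<^sub>v col P k"
  proof (rule eq_vecI)
    fix i assume "i < dim_vec (d k \<cdot>\<^sub>v col P k)"
    then show "(A *\<^sub>v col P k) $ i = (d k \<cdot>\<^sub>v col P k) $ i"
      using AP[of i k] assms P A by auto
  qed (use A P in auto)
  moreover have "col P k \<noteq> 0\<^sub>v n"
  proof
    assume "col P k = 0\<^sub>v n"
    then have "(Q * P) $$ (k,k) = 0" using P Q assms by auto
    then show False unfolding QP using assms by simp
  qed
  ultimately have "eigenvector A (col P k) (d k)"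
    using A P unfolding eigenvector_def by (auto simp: carrier_vecI)
  then show ?thesis unfolding spectrum_def eigenvalue_def by auto
qed

lemma pow_entries_eq_iff_eigenproj_entries_eq:
  assumes "i < n" "j < n" "i' < n" "j' < n"
  shows "(\<forall>l. (A ^\<^sub>m l) $$ (i,j) = (A ^\<^sub>m l) $$ (i',j')) \<longleftrightarrow>
    (\<forall>t\<in>spectrum A. eigenproj A t $$ (i,j) = eigenproj A t $$ (i',j'))"
proof (intro iffI allI ballI)
  fix t assume eq: "\<forall>l. (A ^\<^sub>m l) $$ (i,j) = (A ^\<^sub>m l) $$ (i',j')"
  obtain p where p: "\<And>i j. fun_calc (\<lambda>x. of_bool (x = t)) i j = fun_calc (poly p) i j"
    using fun_calc_as_poly by metis
  show "eigenproj A t $$ (i,j) = eigenproj A t $$ (i',j')"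
    unfolding eigenproj_eq using assms eq by (simp add: p fun_calc_poly)
next
  fix l assume eq: "\<forall>t\<in>spectrum A. eigenproj A t $$ (i,j) = eigenproj A t $$ (i',j')"
  \<comment> \<open>Indices k with the same \<open>d k\<close> are collected, which turns the sum
    over eigenvectors into one over distinct eigenvalues.\<close>
  have "(A ^\<^sub>m l) $$ (a,b) = (\<Sum>t\<in>d ` {..<n}. t ^ l * eigenproj A t $$ (a,b))"
    if "a < n" "b < n" for a b
  proof -
    have "(A ^\<^sub>m l) $$ (a,b)
        = (\<Sum>t\<in>d ` {..<n}. \<Sum>k | k \<in> {..<n} \<and> d k = t. d k ^ l * P $$ (a,k) * Q $$ (k,b))"
      unfolding pow_mat_entry[OF that] fun_calc_def by (rule sum.image_gen) simp
    also have "\<dots> = (\<Sum>t\<in>d ` {..<n}. t ^ l * eigenproj A t $$ (a,b))"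
      unfolding eigenproj_eq fun_calc_def using that
      by (auto simp: sum_distrib_left mult.assoc intro!: sum.cong sum.mono_neutral_cong_left)
    finally show ?thesis .
  qed
  then show "(A ^\<^sub>m l) $$ (i,j) = (A ^\<^sub>m l) $$ (i',j')"
    using assms eq d_in_spectrum by (auto intro!: sum.cong)
qed

end

section \<open>Spectra and walk generating functions\<close>

text \<open>This is I - XA itself; the resolvent proper is its inverse
  \<open>walk_gf\<close>.\<close>

definition resolvent_mat :: "real mat \<Rightarrow> real fps mat" where
  "resolvent_mat A = mat (dim_row A) (dim_row A)
     (\<lambda>(i,j). of_bool (i = j) - fps_X * fps_const (A $$ (i,j)))"

definition walk_gf :: "real mat \<Rightarrow> real fps mat" where
  "walk_gf A = mat (dim_row A) (dim_row A) (\<lambda>(i,j). Abs_fps (\<lambda>l. (A ^\<^sub>m l) $$ (i,j)))"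

lemma resolvent_mat_carrier: "A \<in> carrier_mat n n \<Longrightarrow> resolvent_mat A \<in> carrier_mat n n"
  unfolding resolvent_mat_def by auto

lemma walk_gf_carrier: "A \<in> carrier_mat n n \<Longrightarrow> walk_gf A \<in> carrier_mat n n"
  unfolding walk_gf_def by auto

text \<open>Geometric series: degree 0 leaves the identity, and in degree l + 1 the power A^(l+1)
  cancels against A A^l in the first product and against A^l A in the second.\<close>

lemma resolvent_mat_mult_walk_gf:
  assumes A: "A \<in> carrier_mat n n"
  shows "resolvent_mat A * walk_gf A = 1\<^sub>m n" "walk_gf A * resolvent_mat A = 1\<^sub>m n"
proof -
  have W0: "(A ^\<^sub>m 0) $$ (i,j) = of_bool (i = j)" if "i < n" "j < n" for i j
    using that A by auto
  show "resolvent_mat A * walk_gf A = 1\<^sub>m n"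
  proof (rule eq_matI)
    fix i j assume "i < dim_row (1\<^sub>m n :: real fps mat)" "j < dim_col (1\<^sub>m n :: real fps mat)"
    then have ij: "i < n" "j < n" by auto
    let ?W = "\<lambda>k. Abs_fps (\<lambda>l. (A ^\<^sub>m l) $$ (k,j))"
    have "(resolvent_mat A * walk_gf A) $$ (i,j)
        = (\<Sum>k<n. (of_bool (i = k) - fps_X * fps_const (A $$ (i,k))) * ?W k)"
      using mult_mat_entry[OF resolvent_mat_carrier[OF A] walk_gf_carrier[OF A] ij] ij A
      by (simp add: resolvent_mat_def walk_gf_def)
    also have "\<dots> = ?W i - fps_X * (\<Sum>k<n. fps_const (A $$ (i,k)) * ?W k)"
      using ij by (simp add: left_diff_distrib sum_subtractf sum_distrib_left mult.assoc
          of_bool_def if_distrib[of "\<lambda>x. x * _"] cong: if_cong)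
    also have "\<dots> = of_bool (i = j)"
    proof (rule fps_ext)
      fix l show "fps_nth (?W i - fps_X * (\<Sum>k<n. fps_const (A $$ (i,k)) * ?W k)) l
        = fps_nth (of_bool (i = j)) l"
        using W0[OF ij] ij A mult_mat_entry[OF A _ ij, of "A ^\<^sub>m (l - 1)"] pow_mat_Suc_left[OF A, of "l - 1"]
        by (cases l) (auto simp: fps_sum_nth simp del: pow_mat.simps)
    qed
    finally show "(resolvent_mat A * walk_gf A) $$ (i,j) = 1\<^sub>m n $$ (i,j)" using ij by auto
  qed (use A in \<open>auto simp: resolvent_mat_def walk_gf_def\<close>)
  show "walk_gf A * resolvent_mat A = 1\<^sub>m n"
  proof (rule eq_matI)
    fix i j assume "i < dim_row (1\<^sub>m n :: real fps mat)" "j < dim_col (1\<^sub>m n :: real fps mat)"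
    then have ij: "i < n" "j < n" by auto
    let ?W = "\<lambda>k. Abs_fps (\<lambda>l. (A ^\<^sub>m l) $$ (i,k))"
    have "(walk_gf A * resolvent_mat A) $$ (i,j)
        = (\<Sum>k<n. ?W k * (of_bool (k = j) - fps_X * fps_const (A $$ (k,j))))"
      using mult_mat_entry[OF walk_gf_carrier[OF A] resolvent_mat_carrier[OF A] ij] ij A
      by (simp add: resolvent_mat_def walk_gf_def)
    also have "\<dots> = ?W j - fps_X * (\<Sum>k<n. fps_const (A $$ (k,j)) * ?W k)"
      using ij by (simp add: right_diff_distrib sum_subtractf sum_distrib_left mult_ac
          of_bool_def if_distrib[of "\<lambda>x. x * _"] cong: if_cong)
    also have "\<dots> = of_bool (i = j)"
    proof (rule fps_ext)
      fix l show "fps_nth (?W j - fps_X * (\<Sum>k<n. fps_const (A $$ (k,j)) * ?W k)) l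
        = fps_nth (of_bool (i = j)) l"
        using W0[OF ij] ij A mult_mat_entry[OF _ A ij, of "A ^\<^sub>m (l - 1)"]
        by (cases l) (auto simp: fps_sum_nth mult.commute)
    qed
    finally show "(walk_gf A * resolvent_mat A) $$ (i,j) = 1\<^sub>m n $$ (i,j)" using ij by auto
  qed (use A in \<open>auto simp: resolvent_mat_def walk_gf_def\<close>)
qed

lemma poly_eqI_nonzero:
  fixes p q :: "real poly"
  assumes "\<And>x. x \<noteq> 0 \<Longrightarrow> poly p x = poly q x"
  shows "p = q"
proof -
  have "poly ([:0, 1:] * p) x = poly ([:0, 1:] * q) x" for x
    using assms[of x] by (cases "x = 0") auto
  then have "[:0, 1:] * p = [:0, 1:] * q" by (simp add: poly_eq_poly_eq_iff[symmetric] fun_eq_iff)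
  then show ?thesis by (metis mult_left_cancel pCons_eq_0_iff zero_neq_one)
qed

text \<open>Reversal of polynomials: det (1 - x A) = x ^ n * det (1 / x - A) for nonzero x.\<close>
lemma det_resolvent_mat_eq_iff:
  assumes A: "A \<in> carrier_mat n n" and B: "B \<in> carrier_mat n n"
  shows "det (resolvent_mat A) = det (resolvent_mat B) \<longleftrightarrow> char_poly A = char_poly B"
proof -
  \<comment> \<open>The same matrix I - XC over polynomials, which, unlike power series, can be
    evaluated at real points.\<close>
  define R :: "real mat \<Rightarrow> real poly mat" where
    "R C = mat n n (\<lambda>(i,j). of_bool (i = j) - [:0, C $$ (i,j):])" for C
  interpret fps_hom: comm_ring_hom "fps_of_poly :: real poly \<Rightarrow> real fps"
    by unfold_locales (auto simp: fps_of_poly_add fps_of_poly_mult)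
  have fps: "det (resolvent_mat C) = fps_of_poly (det (R C))" if C: "C \<in> carrier_mat n n" for C
  proof -
    have "resolvent_mat C = map_mat fps_of_poly (R C)"
      by (rule eq_matI) (use C in \<open>auto simp: R_def resolvent_mat_def of_bool_def fps_of_poly_diff fps_of_poly_pCons mult.commute\<close>)
    then show ?thesis by simp
  qed
  have ev: "poly (det (R C)) x = x ^ n * poly (char_poly C) (inverse x)"
    if C: "C \<in> carrier_mat n n" and x: "x \<noteq> 0" for C x
  proof -
    have "poly (det (R C)) x = det (map_mat (\<lambda>p. poly p x) (R C))"
      by (rule comm_ring_hom.hom_det[symmetric]) (unfold_locales, auto)
    also have "map_mat (\<lambda>p. poly p x) (R C) = x \<cdot>\<^sub>m (- char_matrix C (inverse x))"
      by (rule eq_matI) (use C x in \<open>auto simp: R_def char_matrix_def field_simps\<close>)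
    also have "det \<dots> = x ^ n * det (- char_matrix C (inverse x))"
      using char_matrix_closed[OF C, of "inverse x"] by simp
    also have "det (- char_matrix C (inverse x)) = poly (char_poly C) (inverse x)"
      using char_poly_matrix[OF C] by simp
    finally show ?thesis .
  qed
  \<comment> \<open>The factor \<open>x ^ n\<close> is common to both sides since the sizes agree.
    For different sizes the determinant would not see the multiplicity of the eigenvalue 0.\<close>
  have "det (R A) = det (R B) \<longleftrightarrow> char_poly A = char_poly B"
  proof
    assume eq: "det (R A) = det (R B)"
    show "char_poly A = char_poly B"
    proof (rule poly_eqI_nonzero)
      fix x :: real assume "x \<noteq> 0"
      then show "poly (char_poly A) x = poly (char_poly B) x"
        using ev[OF A, of "inverse x"] ev[OF B, of "inverse x"] eq by simp
    qed
  next
    assume "char_poly A = char_poly B"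
    then show "det (R A) = det (R B)" by (intro poly_eqI_nonzero) (simp add: ev A B)
  qed
  then show ?thesis using fps[OF A] fps[OF B] by (simp add: fps_of_poly_eq_iff)
qed

section \<open>Matrices labelled by lists of vertices\<close>

text \<open>Labels in place of indices make it possible to put chosen vertices first and to form
  blocks by appending lists; two lists allow rectangular blocks.\<close>

definition list_mat :: "'b list \<Rightarrow> 'c list \<Rightarrow> ('b \<Rightarrow> 'c \<Rightarrow> 'e) \<Rightarrow> 'e mat" where
  "list_mat xs ys f = mat (length xs) (length ys) (\<lambda>(i,j). f (xs ! i) (ys ! j))"

lemma list_mat_carrier [simp]: "list_mat xs ys f \<in> carrier_mat (length xs) (length ys)"
  unfolding list_mat_def by simp

lemma list_mat_index [simp]:
  "i < length xs \<Longrightarrow> j < length ys \<Longrightarrow> list_mat xs ys f $$ (i,j) = f (xs ! i) (ys ! j)"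
  "dim_row (list_mat xs ys f) = length xs" "dim_col (list_mat xs ys f) = length ys"
  unfolding list_mat_def by auto

text \<open>The sign of the permutation enters once for the rows and once for the columns, the
  latter treated as rows of the transpose, and its square is 1.\<close>

lemma det_list_mat_reorder:
  fixes f :: "'b \<Rightarrow> 'b \<Rightarrow> 'e :: comm_ring_1"
  assumes "distinct xs" "distinct ys" "set xs = set ys"
  shows "det (list_mat xs xs f) = det (list_mat ys ys f)"
proof -
  define n where "n = length ys"
  have "mset xs = mset ys" using assms by (simp add: set_eq_iff_mset_eq_distinct)
  then obtain p where p: "p permutes {..<length ys}" "permute_list p ys = xs"
    using mset_eq_permutation by blast
  have p': "p permutes {0..<n}" using p(1) unfolding n_def by (simp add: lessThan_atLeast0)
  have len: "length xs = n" using p(2) unfolding n_def by auto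
  have pn: "p i < n" if "i < n" for i using permutes_in_image[OF p', of i] that by auto
  have nth: "xs ! i = ys ! p i" if "i < n" for i
    using p that permute_list_nth[of p ys i] unfolding n_def by auto
  define L where "L = list_mat ys ys f"
  have L: "L \<in> carrier_mat n n" unfolding L_def n_def by simp
  define B where "B = mat n n (\<lambda>(i,j). L $$ (p i, j))"
  have B: "B \<in> carrier_mat n n" unfolding B_def by simp
  have "transpose_mat (list_mat xs xs f) = mat n n (\<lambda>(i,j). transpose_mat B $$ (p i, j))"
    by (rule eq_matI) (auto simp: B_def L_def len nth pn n_def[symmetric])
  then have "det (list_mat xs xs f) = signof p * det (transpose_mat B)"
    using det_permute_rows[OF _ p', of "transpose_mat B"] B det_transpose[of "list_mat xs xs f" n] len
    by (metis list_mat_carrier transpose_carrier_mat)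
  also have "\<dots> = signof p * (signof p * det L)"
    unfolding det_transpose[OF B] unfolding B_def det_permute_rows[OF L p'] ..
  also have "\<dots> = det L" by (simp add: sign_def)
  finally show ?thesis unfolding L_def .
qed

abbreviation resolvent_entry :: "('b \<Rightarrow> 'b \<Rightarrow> nat) \<Rightarrow> 'b \<Rightarrow> 'b \<Rightarrow> real fps" where
  "resolvent_entry a x y \<equiv> of_bool (x = y) - fps_X * of_nat (a x y)"

lemma resolvent_list_mat:
  assumes "distinct xs"
  shows "resolvent_mat (list_mat xs xs (\<lambda>x y. real (a x y))) = list_mat xs xs (resolvent_entry a)"
  by (rule eq_matI) (use assms in \<open>auto simp: resolvent_mat_def nth_eq_iff_index_eq fps_of_nat\<close>)

lemma adj_mat_carrier: "adj_mat (V, a) \<in> carrier_mat (card V) (card V)"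
  unfolding adj_mat_def by simp

definition enum_list :: "'b set \<Rightarrow> 'b list" where
  "enum_list V = map (from_nat_into V) [0..<card V]"

lemma enum_list:
  assumes "finite V"
  shows "distinct (enum_list V)" "set (enum_list V) = V" "length (enum_list V) = card V"
  using bij_betw_from_nat_into_finite[OF assms]
  by (auto simp: enum_list_def distinct_map bij_betw_def lessThan_atLeast0)

lemma adj_mat_list_mat:
  "adj_mat (V, a) = list_mat (enum_list V) (enum_list V) (\<lambda>x y. real (a x y))"
  unfolding adj_mat_def list_mat_def enum_list_def by (auto intro!: eq_matI)

text \<open>Frees the determinant from the enumeration built into \<open>adj_mat\<close>: any order
  of the vertices may be chosen, in particular one that starts with the perturbed vertices.\<close>

lemma det_resolvent_adj_mat:
  assumes "distinct xs" "set xs = V"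
  shows "det (resolvent_mat (adj_mat (V, a))) = det (list_mat xs xs (resolvent_entry a))"
proof -
  have V: "finite V" using assms by auto
  show ?thesis
    unfolding adj_mat_list_mat resolvent_list_mat[OF enum_list(1)[OF V]]
    by (rule det_list_mat_reorder) (use enum_list[OF V] assms in auto)
qed

lemma transpose_adj_mat:
  assumes "finite V" "\<And>x y. x \<in> V \<Longrightarrow> y \<in> V \<Longrightarrow> a x y = a y x"
  shows "transpose_mat (adj_mat (V, a)) = adj_mat (V, a)"
proof -
  have mem: "enum_list V ! i \<in> V" if "i < card V" for i
    using nth_mem[of i "enum_list V"] enum_list[OF assms(1)] that by simp
  show ?thesis
    unfolding adj_mat_list_mat
  proof (rule eq_matI)
    fix i j
    let ?M = "list_mat (enum_list V) (enum_list V) (\<lambda>x y. real (a x y))"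
    assume "i < dim_row ?M" "j < dim_col ?M"
    then show "transpose_mat ?M $$ (i,j) = ?M $$ (i,j)"
      using assms(2)[OF mem mem] enum_list(3)[OF assms(1)] by simp
  qed simp_all
qed

text \<open>The vertex sets may differ, as they do for two amalgamations; reversal of the
  characteristic polynomials only requires equal sizes.\<close>

lemma sp_eq_iff:
  assumes fin: "finite V" "finite W" and card: "card V = card W"
    and sym: "\<And>x y. x \<in> V \<Longrightarrow> y \<in> V \<Longrightarrow> a x y = a y x"
      "\<And>x y. x \<in> W \<Longrightarrow> y \<in> W \<Longrightarrow> b x y = b y x"
  shows "sp (V, a) = sp (W, b) \<longleftrightarrow>
    det (resolvent_mat (adj_mat (V, a))) = det (resolvent_mat (adj_mat (W, b)))"
proof -
  have "sp (V, a) = sp (W, b) \<longleftrightarrow> char_poly (adj_mat (V, a)) = char_poly (adj_mat (W, b))"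
    unfolding sp_def
    by (rule symmetric_proots_char_poly_eq_iff[OF adj_mat_carrier
          transpose_adj_mat[OF fin(1) sym(1)] adj_mat_carrier transpose_adj_mat[OF fin(2) sym(2)]])
  also have "\<dots> \<longleftrightarrow> det (resolvent_mat (adj_mat (V, a))) = det (resolvent_mat (adj_mat (W, b)))"
    by (rule det_resolvent_mat_eq_iff[symmetric, OF adj_mat_carrier])
      (use adj_mat_carrier[of W b] card in simp)
  finally show ?thesis .
qed

section \<open>Schur complements\<close>

text \<open>Block elimination: the unitriangular factor containing \<open>Q * N'\<close> clears the
  upper right block. The inverse is supplied as a matrix, since over a domain a nonzero determinant
  does not yield one.\<close>

lemma det_schur_complement:
  fixes N :: "'a :: idom mat"
  assumes P: "P \<in> carrier_mat k k" and Q: "Q \<in> carrier_mat k m"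
    and R: "R \<in> carrier_mat m k" and N: "N \<in> carrier_mat m m" and N': "N' \<in> carrier_mat m m"
    and inv: "N' * N = 1\<^sub>m m"
  shows "det (four_block_mat P Q R N) = det N * det (P - Q * N' * R)"
proof -
  let ?U = "four_block_mat (1\<^sub>m k) (Q * N') (0\<^sub>m m k) (1\<^sub>m m)"
  let ?L = "four_block_mat (P - Q * N' * R) (0\<^sub>m k m) R N"
  have "?U * ?L = four_block_mat (1\<^sub>m k * (P - Q * N' * R) + Q * N' * R) (1\<^sub>m k * 0\<^sub>m k m + Q * N' * N)
      (0\<^sub>m m k * (P - Q * N' * R) + 1\<^sub>m m * R) (0\<^sub>m m k * 0\<^sub>m k m + 1\<^sub>m m * N)"
    by (rule mult_four_block_mat) (use P Q R N N' in auto)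
  also have "1\<^sub>m k * (P - Q * N' * R) + Q * N' * R = P"
    by (rule eq_matI) (use P Q R N' in auto)
  also have "1\<^sub>m k * 0\<^sub>m k m + Q * N' * N = Q"
    using Q N N' inv by (simp add: assoc_mult_mat[OF Q N' N])
  also have "0\<^sub>m m k * (P - Q * N' * R) + 1\<^sub>m m * R = R"
    using P Q R N' by (simp add: minus_carrier_mat)
  also have "0\<^sub>m m k * 0\<^sub>m k m + 1\<^sub>m m * N = N"
    using N by simp
  finally have "four_block_mat P Q R N = ?U * ?L" ..
  moreover have "?U \<in> carrier_mat (k + m) (k + m)" "?L \<in> carrier_mat (k + m) (k + m)"
    using P Q R N N' by (auto intro!: four_block_carrier_mat)
  ultimately have "det (four_block_mat P Q R N) = det ?U * det ?L"
    using det_mult by metis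
  also have "det ?U = 1"
    by (subst det_four_block_mat_lower_left_zero[of _ k _ m]) (use Q N' in auto)
  also have "det ?L = det (P - Q * N' * R) * det N"
    by (rule det_four_block_mat_upper_right_zero[of _ k _ m]) (use P Q R N N' in auto)
  finally show ?thesis by (simp add: mult.commute)
qed

text \<open>The form c^T M b, with vectors given as plain functions, so that rows and columns can be
  added and scaled without carrier conditions.\<close>

definition bilin :: "'a :: comm_ring_1 mat \<Rightarrow> (nat \<Rightarrow> 'a) \<Rightarrow> (nat \<Rightarrow> 'a) \<Rightarrow> 'a" where
  "bilin M c b = (\<Sum>i<dim_row M. \<Sum>j<dim_row M. c i * M $$ (i,j) * b j)"

lemma bilin_add:
  "bilin M (\<lambda>i. c i + c' i) b = bilin M c b + bilin M c' b"
  "bilin M c (\<lambda>i. b i + b' i) = bilin M c b + bilin M c b'"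
  by (simp_all add: bilin_def algebra_simps sum.distrib)

lemma bilin_0:
  "bilin M (\<lambda>i. 0) b = 0" "bilin M c (\<lambda>i. 0) = 0"
  by (simp_all add: bilin_def)

lemma bilin_scale_right: "bilin M c (\<lambda>i. b i * k) = bilin M c b * k"
  by (simp add: bilin_def sum_distrib_right mult.assoc)

lemma bilin_uminus_sum_right: "bilin M c (\<lambda>i. - (\<Sum>k\<in>K. b k i)) = - (\<Sum>k\<in>K. bilin M c (b k))"
proof -
  have "bilin M c (\<lambda>i. - (\<Sum>k\<in>K. b k i))
      = - (\<Sum>i<dim_row M. \<Sum>j<dim_row M. \<Sum>k\<in>K. c i * M $$ (i,j) * b k j)"
    by (simp add: bilin_def sum_distrib_left sum_negf)
  also have "(\<Sum>i<dim_row M. \<Sum>j<dim_row M. \<Sum>k\<in>K. c i * M $$ (i,j) * b k j)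
      = (\<Sum>i<dim_row M. \<Sum>k\<in>K. \<Sum>j<dim_row M. c i * M $$ (i,j) * b k j)"
    by (intro sum.cong refl sum.swap)
  also have "\<dots> = (\<Sum>k\<in>K. bilin M c (b k))" unfolding bilin_def by (rule sum.swap)
  finally show ?thesis .
qed

lemma bilin_mult_vec:
  assumes "M \<in> carrier_mat m m" "N \<in> carrier_mat m m" "M * N = 1\<^sub>m m"
  shows "bilin M c (\<lambda>i. \<Sum>k<m. N $$ (i,k) * b k) = (\<Sum>i<m. c i * b i)"
proof -
  have dim: "dim_row M = m" using assms by simp
  have "bilin M c (\<lambda>i. \<Sum>k<m. N $$ (i,k) * b k)
      = (\<Sum>i<m. \<Sum>j<m. \<Sum>k<m. c i * b k * (M $$ (i,j) * N $$ (j,k)))"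
    by (simp add: bilin_def dim sum_distrib_left mult_ac)
  also have "\<dots> = (\<Sum>i<m. \<Sum>k<m. \<Sum>j<m. c i * b k * (M $$ (i,j) * N $$ (j,k)))"
    by (intro sum.cong refl sum.swap)
  also have "\<dots> = (\<Sum>i<m. \<Sum>k<m. c i * b k * (M * N) $$ (i,k))"
    by (intro sum.cong refl) (simp add: mult_mat_entry[OF assms(1,2)] sum_distrib_left)
  also have "\<dots> = (\<Sum>i<m. c i * b i)"
  proof (intro sum.cong refl)
    fix i assume i: "i \<in> {..<m}"
    have "(\<Sum>k<m. c i * b k * (M * N) $$ (i,k)) = (\<Sum>k\<in>{i}. c i * b k * (M * N) $$ (i,k))"
      by (rule sum.mono_neutral_right) (use i assms(3) in auto)
    then show "(\<Sum>k<m. c i * b k * (M * N) $$ (i,k)) = c i * b i" using i assms(3) by simp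
  qed
  finally show ?thesis .
qed

text \<open>An entry of P - Q N' R, where \<open>N'\<close> is meant to invert the block of
  \<open>g\<close> on \<open>zs\<close>. As a function on labels it can itself serve as the
  \<open>g\<close> of a further complement.\<close>

definition schur :: "'a :: comm_ring_1 mat \<Rightarrow> 'b list \<Rightarrow> ('b \<Rightarrow> 'b \<Rightarrow> 'a) \<Rightarrow> 'b \<Rightarrow> 'b \<Rightarrow> 'a" where
  "schur N' zs g x y = g x y - bilin N' (\<lambda>i. g x (zs ! i)) (\<lambda>j. g (zs ! j) y)"

lemma det_list_mat_append:
  fixes g :: "'b \<Rightarrow> 'b \<Rightarrow> 'a :: idom"
  assumes N': "N' \<in> carrier_mat (length zs) (length zs)"
    and inv: "N' * list_mat zs zs g = 1\<^sub>m (length zs)"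
  shows "det (list_mat (ys @ zs) (ys @ zs) g) = det (list_mat zs zs g) * det (list_mat ys ys (schur N' zs g))"
proof -
  let ?Q = "list_mat ys zs g" and ?R = "list_mat zs ys g"
  have "list_mat (ys @ zs) (ys @ zs) g
      = four_block_mat (list_mat ys ys g) ?Q ?R (list_mat zs zs g)"
    by (rule eq_matI) (auto simp: nth_append)
  also have "det \<dots> = det (list_mat zs zs g) * det (list_mat ys ys g - ?Q * N' * ?R)"
    by (rule det_schur_complement[OF list_mat_carrier list_mat_carrier list_mat_carrier list_mat_carrier N' inv])
  also have "list_mat ys ys g - ?Q * N' * ?R = list_mat ys ys (schur N' zs g)"
  proof (rule eq_matI)
    fix x y assume "x < dim_row (list_mat ys ys (schur N' zs g))" "y < dim_col (list_mat ys ys (schur N' zs g))"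
    then have xy: "x < length ys" "y < length ys" by auto
    have QN: "?Q * N' \<in> carrier_mat (length ys) (length zs)"
      using N' by (intro mult_carrier_mat[OF list_mat_carrier])
    have "(?Q * N' * ?R) $$ (x,y)
        = (\<Sum>j<length zs. (\<Sum>i<length zs. g (ys ! x) (zs ! i) * N' $$ (i,j)) * g (zs ! j) (ys ! y))"
      using xy mult_mat_entry[OF QN list_mat_carrier[of zs ys g] xy]
        mult_mat_entry[OF list_mat_carrier[of ys zs g] N' xy(1)] by simp
    also have "\<dots> = bilin N' (\<lambda>i. g (ys ! x) (zs ! i)) (\<lambda>j. g (zs ! j) (ys ! y))"
      using N' unfolding bilin_def sum_distrib_right by (subst sum.swap) simp
    finally show "(list_mat ys ys g - ?Q * N' * ?R) $$ (x,y) = list_mat ys ys (schur N' zs g) $$ (x,y)"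
      using xy N' by (simp add: schur_def)
  qed (use N' in auto)
  finally show ?thesis .
qed

text \<open>A block of the inverse is inverse to the Schur complement. The rows of g T = 1 with
  labels in \<open>zs\<close> have right-hand side 0 at y, so they express T on \<open>zs\<close>
  through T on \<open>ys\<close>; substitution into a row with label in \<open>ys\<close> leaves the
  complement.\<close>

lemma schur_mult_inverse:
  fixes g :: "'b \<Rightarrow> 'b \<Rightarrow> 'a :: idom"
  assumes dist: "distinct (ys @ zs)"
    and N': "N' \<in> carrier_mat (length zs) (length zs)"
    and inv: "N' * list_mat zs zs g = 1\<^sub>m (length zs)"
    and T: "\<And>x y. x \<in> set (ys @ zs) \<Longrightarrow> y \<in> set (ys @ zs) \<Longrightarrow>
      (\<Sum>k\<in>set (ys @ zs). g x k * T k y) = of_bool (x = y)"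
    and x: "x \<in> set ys" and y: "y \<in> set ys"
  shows "(\<Sum>k\<in>set ys. schur N' zs g x k * T k y) = of_bool (x = y)"
proof -
  let ?m = "length zs"
  have split: "(\<Sum>k\<in>set (ys @ zs). f k) = (\<Sum>k\<in>set ys. f k) + (\<Sum>i<?m. f (zs ! i))" for f :: "'b \<Rightarrow> 'a"
  proof -
    have "(\<Sum>k\<in>set zs. f k) = (\<Sum>i<?m. f (zs ! i))"
      using dist by (intro sum.reindex_bij_betw[symmetric] bij_betw_nth) auto
    then show ?thesis using dist by (simp add: sum.union_disjoint)
  qed
  have rest: "(\<Sum>k<?m. list_mat zs zs g $$ (i,k) * T (zs ! k) y) = - (\<Sum>k\<in>set ys. g (zs ! i) k * T k y)"
    if i: "i < ?m" for i
  proof -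
    have "zs ! i \<noteq> y" using dist i y by auto
    then have "(\<Sum>k\<in>set ys. g (zs ! i) k * T k y) + (\<Sum>k<?m. g (zs ! i) (zs ! k) * T (zs ! k) y) = 0"
      using T[of "zs ! i" y] i y unfolding split by simp
    moreover have "(\<Sum>k<?m. list_mat zs zs g $$ (i,k) * T (zs ! k) y)
        = (\<Sum>k<?m. g (zs ! i) (zs ! k) * T (zs ! k) y)"
      using i by (intro sum.cong) auto
    ultimately show ?thesis by (simp add: eq_neg_iff_add_eq_0 add.commute)
  qed
  let ?c = "\<lambda>i. g x (zs ! i)"
  \<comment> \<open>The product of \<open>N'\<close> with the block on \<open>zs\<close> is inserted
    as an identity, so that \<open>rest\<close> can trade the sum over \<open>zs\<close> for one
    over \<open>ys\<close>.\<close>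
  have "(\<Sum>i<?m. ?c i * T (zs ! i) y) = bilin N' ?c (\<lambda>i. \<Sum>k<?m. list_mat zs zs g $$ (i,k) * T (zs ! k) y)"
    using bilin_mult_vec[OF N' list_mat_carrier inv] by simp
  also have "\<dots> = bilin N' ?c (\<lambda>i. - (\<Sum>k\<in>set ys. g (zs ! i) k * T k y))"
    using N' rest unfolding bilin_def by (intro sum.cong) auto
  also have "\<dots> = - (\<Sum>k\<in>set ys. bilin N' ?c (\<lambda>i. g (zs ! i) k) * T k y)"
    unfolding bilin_uminus_sum_right bilin_scale_right ..
  finally have "(\<Sum>k\<in>set ys. schur N' zs g x k * T k y)
      = (\<Sum>k\<in>set ys. g x k * T k y) + (\<Sum>i<?m. ?c i * T (zs ! i) y)"
    by (simp add: schur_def left_diff_distrib sum_subtractf)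
  also have "\<dots> = of_bool (x = y)" using T[of x y] x y unfolding split by simp
  finally show ?thesis .
qed

lemma det_list_mat_1: "det (list_mat [x] [x] f) = f x x"
  by (subst det_single) (auto simp: list_mat_def)

lemma det_list_mat_2:
  fixes f :: "'b \<Rightarrow> 'b \<Rightarrow> 'a :: idom"
  shows "det (list_mat [x,y] [x,y] f) = f x x * f y y - f x y * f y x"
proof -
  have "list_mat [x,y] [x,y] f = four_block_mat (list_mat [x] [x] f) (list_mat [x] [y] f)
      (list_mat [y] [x] f) (list_mat [y] [y] f)"
    by (rule eq_matI) (auto simp: less_Suc_eq)
  also have "det \<dots> = det (list_mat [x] [x] f * list_mat [y] [y] f - list_mat [x] [y] f * list_mat [y] [x] f)"
    by (rule det_four_block_mat[of _ 1]) (auto simp: list_mat_def scalar_prod_def mult.commute intro!: eq_matI)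
  also have "\<dots> = f x x * f y y - f x y * f y x"
    by (subst det_single) (auto simp: list_mat_def scalar_prod_def)
  finally show ?thesis .
qed

text \<open>Cramer's rule without division, for S = [[a,b],[c,e]] inverse to [[r,t],[t,r]]. In the
  application \<open>\<delta>\<close> is the determinant of the eliminated block and
  \<open>\<phi>\<close> that of the whole matrix.\<close>

lemma symmetric_two_by_two_inverse:
  fixes r t :: "'a :: idom"
  assumes "a * r + b * t = 1" "a * t + b * r = 0" "c * r + e * t = 0" "c * t + e * r = 1"
    and "r\<^sup>2 - t\<^sup>2 \<noteq> 0" and phi: "\<phi> = \<delta> * (a * e - b * c)"
  shows "\<delta> = \<phi> * (r\<^sup>2 - t\<^sup>2)" "\<delta> * a = \<phi> * r" "\<delta> * b = - (\<phi> * t)" "\<delta> * c = - (\<phi> * t)" "\<delta> * e = \<phi> * r"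
proof -
  define \<rho> where "\<rho> = r\<^sup>2 - t\<^sup>2"
  have "a * \<rho> = r * (a * r + b * t) - t * (a * t + b * r)"
    "b * \<rho> = r * (a * t + b * r) - t * (a * r + b * t)"
    "c * \<rho> = r * (c * r + e * t) - t * (c * t + e * r)"
    "e * \<rho> = r * (c * t + e * r) - t * (c * r + e * t)"
    by (simp_all add: \<rho>_def power2_eq_square algebra_simps)
  then have sc: "a * \<rho> = r" "b * \<rho> = - t" "c * \<rho> = - t" "e * \<rho> = r"
    unfolding assms(1-4) by simp_all
  have "\<rho> * (\<rho> * (a * e - b * c)) = (a * \<rho>) * (e * \<rho>) - (b * \<rho>) * (c * \<rho>)"
    by (simp add: algebra_simps)
  also have "\<dots> = \<rho> * 1" unfolding sc by (simp add: \<rho>_def power2_eq_square)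
  finally have "\<rho> * (a * e - b * c) = 1" using assms(5) unfolding \<rho>_def by (metis mult_left_cancel)
  then have d: "\<delta> = \<phi> * \<rho>" unfolding phi by (metis mult.assoc mult.commute mult_1_right)
  then show "\<delta> = \<phi> * (r\<^sup>2 - t\<^sup>2)" unfolding \<rho>_def .
  show "\<delta> * a = \<phi> * r" "\<delta> * b = - (\<phi> * t)" "\<delta> * c = - (\<phi> * t)" "\<delta> * e = \<phi> * r"
    using sc unfolding d by (simp_all add: mult.assoc mult.commute[of \<rho>])
qed

section \<open>Perturbations of a walk-regular graph\<close>

lemma det_resolvent_mat_nonzero:
  assumes "A \<in> carrier_mat n n"
  shows "det (resolvent_mat A) \<noteq> 0"
proof
  assume "det (resolvent_mat A) = 0"
  then have "det (resolvent_mat A * walk_gf A) = 0"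
    using det_mult[OF resolvent_mat_carrier walk_gf_carrier] assms by simp
  then show False unfolding resolvent_mat_mult_walk_gf(1)[OF assms] by simp
qed

text \<open>A principal block of I - XA is the matrix of the same kind for the restricted adjacency,
  hence inverted by the walk series of the restriction.\<close>

lemma resolvent_list_mat_left_inverse:
  fixes a :: "'b \<Rightarrow> 'b \<Rightarrow> nat"
  assumes "distinct zs"
  obtains N' where "N' \<in> carrier_mat (length zs) (length zs)"
    "N' * list_mat zs zs (resolvent_entry a) = 1\<^sub>m (length zs)"
proof
  let ?A = "list_mat zs zs (\<lambda>x y. real (a x y))"
  show "walk_gf ?A \<in> carrier_mat (length zs) (length zs)" by (simp add: walk_gf_carrier)
  show "walk_gf ?A * list_mat zs zs (resolvent_entry a) = 1\<^sub>m (length zs)"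
    using resolvent_mat_mult_walk_gf(2)[of ?A "length zs"] resolvent_list_mat[OF assms, of a] by simp
qed

lemma list_mat_cong:
  assumes "\<And>x y. x \<in> set xs \<Longrightarrow> y \<in> set ys \<Longrightarrow> f x y = g x y"
  shows "list_mat xs ys f = list_mat xs ys g"
  by (rule eq_matI) (use assms in auto)

lemma list_mat_map: "list_mat (map h xs) (map h ys) f = list_mat xs ys (\<lambda>x y. f (h x) (h y))"
  by (rule eq_matI) auto

lemma bilin_cong:
  assumes "M \<in> carrier_mat m m" "\<And>i. i < m \<Longrightarrow> c i = c' i" "\<And>i. i < m \<Longrightarrow> b i = b' i"
  shows "bilin M c b = bilin M c' b'"
  unfolding bilin_def using assms by (intro sum.cong) auto

text \<open>If the couplings to the eliminated vertices stay the same, so does the correction term,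
  and a change of the entry passes unaltered to the complement.\<close>

lemma schur_perturb:
  assumes "N' \<in> carrier_mat (length zs) (length zs)"
    and "\<And>z. z \<in> set zs \<Longrightarrow> f x z = g x z" "\<And>z. z \<in> set zs \<Longrightarrow> f z y = g z y"
  shows "schur N' zs f x y = schur N' zs g x y + (f x y - g x y)"
proof -
  have "bilin N' (\<lambda>i. f x (zs ! i)) (\<lambda>j. f (zs ! j) y) = bilin N' (\<lambda>i. g x (zs ! i)) (\<lambda>j. g (zs ! j) y)"
    using assms by (intro bilin_cong) auto
  then show ?thesis unfolding schur_def by simp
qed

section \<open>Distance and adjacency\<close>

lemma gdist_ge_1:
  assumes "pair_graph G" "u \<noteq> v"
  shows "gdist G u v \<ge> 1"
proof -
  interpret pair_graph G by fact
  show ?thesis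
    unfolding gdist_def \<mu>_def
  proof (rule INF_greatest)
    fix p assume "p \<in> {p. awalk u p v}"
    then have "p \<noteq> []" using assms(2) by (auto simp: awalk_def)
    then have "real (length p) \<ge> 1" by (cases p) auto
    then show "1 \<le> ereal (awalk_cost (\<lambda>_. 1) p)" by (simp add: awalk_cost_def sum_list_triv)
  qed
qed

text \<open>Serves to read the adjacency of two vertices off their distance, which makes the
  adjacency term of the determinants a function of h.\<close>

lemma gdist_adj:
  assumes G: "pair_graph G" and u: "u \<in> pverts G" and uv: "u \<noteq> v"
  shows "gdist G u v = 1 \<longleftrightarrow> (u, v) \<in> parcs G"
proof
  interpret pair_graph G by fact
  assume "(u, v) \<in> parcs G"
  then have "awalk u [(u, v)] v" using u in_arcsD2 by (auto simp: awalk_def)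
  then have "gdist G u v \<le> 1"
    using min_cost_le_walk_cost[of u "[(u, v)]" v "\<lambda>_. 1"] by (simp add: gdist_def one_ereal_def)
  then show "gdist G u v = 1" using gdist_ge_1[OF G uv] by (rule antisym)
next
  interpret pair_graph G by fact
  assume d: "gdist G u v = 1"
  show "(u, v) \<in> parcs G"
  proof (rule ccontr)
    assume nadj: "(u, v) \<notin> parcs G"
    have "2 \<le> gdist G u v"
      unfolding gdist_def \<mu>_def
    proof (rule INF_greatest)
      fix p assume "p \<in> {p. awalk u p v}"
      then have p: "awalk u p v" by simp
      have "length p \<ge> 2"
      proof (rule ccontr)
        assume "\<not> length p \<ge> 2"
        then consider "p = []" | e where "p = [e]" by (cases p; cases "tl p") auto
        then show False
          by cases (use p uv nadj in \<open>auto simp: awalk_def\<close>)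
      qed
      then have "real (length p) \<ge> 2" by simp
      then show "2 \<le> ereal (awalk_cost (\<lambda>_. 1) p)" by (simp add: awalk_cost_def sum_list_triv)
    qed
    then show False unfolding d by simp
  qed
qed

locale walk_regular_pair_graph =
  fixes G :: "'a pair_pre_digraph"
  assumes G: "pair_graph G" and wr: "walk_regular G"
begin

abbreviation "V \<equiv> pverts G"

definition T :: "'a \<Rightarrow> 'a \<Rightarrow> real fps" where
  "T x y = Abs_fps (\<lambda>l. entry V (gmat G ^\<^sub>m l) x y)"

definition \<phi> :: "real fps" where
  "\<phi> = det (resolvent_mat (gmat G))"

definition char_det :: "'b pseudograph \<Rightarrow> real fps" where
  "char_det H = det (resolvent_mat (adj_mat H))"

lemma finV: "finite V"
  using G by (simp add: pair_graph_def pair_digraph_def pair_fin_digraph_def pair_fin_digraph_axioms_def)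

lemma adj_sym: "adj G x y = adj G y x"
proof -
  interpret pair_graph G by (rule G)
  have "(x, y) \<in> parcs G \<longleftrightarrow> (y, x) \<in> parcs G" using arcs_symmetric by blast
  then show ?thesis by (simp add: adj_def)
qed

lemma adj_self: "adj G x x = 0"
proof -
  interpret pair_graph G by (rule G)
  show ?thesis using no_loops' by (auto simp: adj_def)
qed

lemma adj_le_1: "adj G x y \<le> 1"
  by (simp add: adj_def)

lemma gmat_carrier: "gmat G \<in> carrier_mat (card V) (card V)"
  unfolding gmat_def by (rule adj_mat_carrier)

lemma transpose_gmat: "transpose_mat (gmat G) = gmat G"
  unfolding gmat_def by (rule transpose_adj_mat[OF finV]) (rule adj_sym)

lemma idx_less: "x \<in> V \<Longrightarrow> to_nat_on V x < card V"
  using bij_betw_apply[OF to_nat_on_finite[OF finV]] by blast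

lemma idx_eq_iff: "x \<in> V \<Longrightarrow> y \<in> V \<Longrightarrow> to_nat_on V x = to_nat_on V y \<longleftrightarrow> x = y"
  by (rule inj_on_eq_iff[OF bij_betw_imp_inj_on[OF to_nat_on_finite[OF finV]]])

lemma gmat_entry: "x \<in> V \<Longrightarrow> y \<in> V \<Longrightarrow> gmat G $$ (to_nat_on V x, to_nat_on V y) = real (adj G x y)"
  using idx_less finV by (simp add: gmat_def adj_mat_def countable_finite)

lemma T_sym:
  assumes "x \<in> V" "y \<in> V"
  shows "T x y = T y x"
proof -
  have "entry V (gmat G ^\<^sub>m l) x y = entry V (gmat G ^\<^sub>m l) y x" for l
    using arg_cong[OF transpose_pow_mat[OF gmat_carrier transpose_gmat, of l],
        of "\<lambda>M. M $$ (to_nat_on V x, to_nat_on V y)"]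
      carrier_matD[OF pow_carrier_mat[OF gmat_carrier, of l]] idx_less assms
    by (simp add: entry_def del: pow_mat_dim_square)
  then show ?thesis unfolding T_def by simp
qed

lemma T_diag: "x \<in> V \<Longrightarrow> y \<in> V \<Longrightarrow> T x x = T y y"
  using wr unfolding T_def walk_regular_def by metis

lemma T_nth_0: "x \<in> V \<Longrightarrow> y \<in> V \<Longrightarrow> fps_nth (T x y) 0 = of_bool (x = y)"
  using idx_less idx_eq_iff gmat_carrier unfolding T_def entry_def by auto

lemma T_eq_iff:
  "T x y = T x' y' \<longleftrightarrow> (\<forall>l. entry V (gmat G ^\<^sub>m l) x y = entry V (gmat G ^\<^sub>m l) x' y')"
  by (simp add: T_def fps_eq_iff)

lemma resolvent_mult_T:
  assumes x: "x \<in> V" and y: "y \<in> V"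
  shows "(\<Sum>k\<in>V. resolvent_entry (adj G) x k * T k y) = of_bool (x = y)"
proof -
  let ?i = "to_nat_on V"
  have dim: "dim_row (gmat G) = card V" using gmat_carrier by simp
  have "(\<Sum>k\<in>V. resolvent_entry (adj G) x k * T k y)
      = (\<Sum>k\<in>V. resolvent_mat (gmat G) $$ (?i x, ?i k) * walk_gf (gmat G) $$ (?i k, ?i y))"
    using x y idx_less
    by (intro sum.cong)
      (simp_all add: resolvent_mat_def walk_gf_def dim gmat_entry idx_eq_iff T_def entry_def fps_of_nat)
  also have "\<dots> = (\<Sum>k<card V. resolvent_mat (gmat G) $$ (?i x, k) * walk_gf (gmat G) $$ (k, ?i y))"
    by (rule sum.reindex_bij_betw[OF to_nat_on_finite[OF finV]])
  also have "\<dots> = (resolvent_mat (gmat G) * walk_gf (gmat G)) $$ (?i x, ?i y)"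
    using mult_mat_entry[OF resolvent_mat_carrier[OF gmat_carrier] walk_gf_carrier[OF gmat_carrier]
        idx_less[OF x] idx_less[OF y]] by simp
  also have "\<dots> = of_bool (x = y)"
    unfolding resolvent_mat_mult_walk_gf(1)[OF gmat_carrier]
    using idx_less idx_eq_iff x y by simp
  finally show ?thesis .
qed

lemma \<phi>_nonzero: "\<phi> \<noteq> 0"
  unfolding \<phi>_def by (rule det_resolvent_mat_nonzero[OF gmat_carrier])

lemma schur_mult_T:
  assumes dist: "distinct (ys @ zs)" and V: "set (ys @ zs) = V"
    and N': "N' \<in> carrier_mat (length zs) (length zs)"
      "N' * list_mat zs zs (resolvent_entry (adj G)) = 1\<^sub>m (length zs)"
    and "x \<in> set ys" "y \<in> set ys"
  shows "(\<Sum>k\<in>set ys. schur N' zs (resolvent_entry (adj G)) x k * T k y) = of_bool (x = y)"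
  by (rule schur_mult_inverse[OF dist N' _ assms(5,6)]) (unfold V, rule resolvent_mult_T)

lemma \<phi>_list: "distinct xs \<Longrightarrow> set xs = V \<Longrightarrow> \<phi> = det (list_mat xs xs (resolvent_entry (adj G)))"
  unfolding \<phi>_def gmat_def by (rule det_resolvent_adj_mat)

section \<open>Determinants of the perturbed graphs\<close>

text \<open>The 1 x 1 Schur complement at u is inverse to \<open>T u u\<close>, and the loop
  subtracts X from it.\<close>

lemma char_det_loop:
  assumes u: "u \<in> V"
  shows "char_det (flip G u u) = \<phi> * (1 - fps_X * T u u)"
proof -
  let ?g = "resolvent_entry (adj G)"
  let ?f = "resolvent_entry (snd (flip G u u))"
  obtain zs where zs: "set zs = V - {u}" "distinct zs"
    using finite_distinct_list[of "V - {u}"] finV by auto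
  obtain N' where N': "N' \<in> carrier_mat (length zs) (length zs)"
      "N' * list_mat zs zs ?g = 1\<^sub>m (length zs)"
    using resolvent_list_mat_left_inverse[OF zs(2)] by blast
  have xs: "distinct ([u] @ zs)" "set ([u] @ zs) = V" using zs u by auto
  have inner: "list_mat zs zs ?f = list_mat zs zs ?g"
    by (rule list_mat_cong) (use zs in \<open>auto simp: flip_def\<close>)
  define \<delta> where "\<delta> = det (list_mat zs zs ?g)"
  let ?S = "schur N' zs ?g"
  have phi: "\<phi> = \<delta> * ?S u u"
    unfolding \<phi>_list[OF xs] \<delta>_def det_list_mat_append[OF N'] det_list_mat_1 ..
  have "char_det (flip G u u) = det (list_mat ([u] @ zs) ([u] @ zs) ?f)"
    unfolding char_det_def using det_resolvent_adj_mat[OF xs] by (simp add: flip_def)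
  also have "\<dots> = \<delta> * schur N' zs ?f u u"
    using det_list_mat_append[of N' zs ?f "[u]"] N' unfolding inner det_list_mat_1 \<delta>_def by simp
  also have "schur N' zs ?f u u = ?S u u + (?f u u - ?g u u)"
    by (rule schur_perturb[OF N'(1)]) (use zs in \<open>auto simp: flip_def doubleton_eq_iff\<close>)
  also have "?f u u - ?g u u = - fps_X" by (simp add: flip_def adj_self)
  also have "\<delta> * (?S u u + - fps_X) = \<phi> * (1 - fps_X * T u u)"
  proof -
    have "?S u u * T u u = 1" using schur_mult_T[OF xs N', of u u] by simp
    then have "\<delta> = \<phi> * T u u" unfolding phi by (simp add: mult.assoc)
    then show ?thesis using phi by (simp add: algebra_simps)
  qed
  finally show ?thesis .
qed

lemma char_det_pair:
  assumes uv: "u \<in> V" "v \<in> V" "u \<noteq> v"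
  defines "r \<equiv> T u u" and "t \<equiv> T u v" and "c \<equiv> of_nat (adj G u v) :: real fps"
  shows "char_det (flip G u v)
      = \<phi> * (1 - 2 * (1 - 2 * c) * fps_X * t - (1 - 2 * c)\<^sup>2 * fps_X\<^sup>2 * (r\<^sup>2 - t\<^sup>2))"
    and "char_det (amalgamate G u v) = \<phi> * (2 * r - 2 * t - (1 - fps_X * c) * (r\<^sup>2 - t\<^sup>2))"
    and "char_det (add_path G u v) = \<phi> * (1 - 2 * fps_X\<^sup>2 * (r + t))"
proof -
  let ?g = "resolvent_entry (adj G)"
  obtain zs where zs: "set zs = V - {u,v}" "distinct zs"
    using finite_distinct_list[of "V - {u,v}"] finV by auto
  obtain N' where N': "N' \<in> carrier_mat (length zs) (length zs)"
      "N' * list_mat zs zs ?g = 1\<^sub>m (length zs)"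
    using resolvent_list_mat_left_inverse[OF zs(2)] by blast
  have xs: "distinct ([u,v] @ zs)" "set ([u,v] @ zs) = V" using zs uv by auto
  define \<delta> where "\<delta> = det (list_mat zs zs ?g)"
  define S where "S = schur N' zs ?g"
  have phi: "\<phi> = \<delta> * (S u u * S v v - S u v * S v u)"
    unfolding \<phi>_list[OF xs] \<delta>_def S_def det_list_mat_append[OF N'] det_list_mat_2 ..
  have Tr: "T v v = r" "T v u = t" "T u u = r" "T u v = t"
    using T_diag[OF uv(2,1)] T_sym[OF uv(2,1)] unfolding r_def t_def by auto
  have ST: "S x u * T u y + S x v * T v y = of_bool (x = y)" if "x \<in> {u,v}" "y \<in> {u,v}" for x y
    using schur_mult_T[OF xs N', of x y] that uv(3) unfolding S_def by simp
  have inv: "S u u * r + S u v * t = 1" "S u u * t + S u v * r = 0"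
      "S v u * r + S v v * t = 0" "S v u * t + S v v * r = 1"
    using ST[of u u] ST[of u v] ST[of v u] ST[of v v] uv(3) unfolding Tr by auto
  \<comment> \<open>Constant terms count walks of length 0: one from u to itself, none from u to
    v.\<close>
  have "fps_nth (r\<^sup>2 - t\<^sup>2) 0 = 1"
    using T_nth_0[of u u] T_nth_0[of u v] uv by (simp add: r_def t_def power2_eq_square)
  then have \<rho>: "r\<^sup>2 - t\<^sup>2 \<noteq> 0" by auto
  note \<delta> = symmetric_two_by_two_inverse[OF inv \<rho> phi]
  show "char_det (flip G u v)
      = \<phi> * (1 - 2 * (1 - 2 * c) * fps_X * t - (1 - 2 * c)\<^sup>2 * fps_X\<^sup>2 * (r\<^sup>2 - t\<^sup>2))"
  proof -
    let ?f = "resolvent_entry (snd (flip G u v))"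
    \<comment> \<open>The factor 1 - 2c is the change of the adjacency entry under flipping: 1 when
      the edge is added, -1 when it is deleted.\<close>
    define s where "s = (1 - 2 * c) * fps_X"
    have inner: "list_mat zs zs ?f = list_mat zs zs ?g"
      by (rule list_mat_cong) (use zs in \<open>auto simp: flip_def doubleton_eq_iff\<close>)
    have Sf: "schur N' zs ?f x y = S x y + (?f x y - ?g x y)" if "x \<in> {u,v}" "y \<in> {u,v}" for x y
      unfolding S_def
      by (rule schur_perturb[OF N'(1)]) (use zs that in \<open>auto simp: flip_def doubleton_eq_iff\<close>)
    have d: "?f u u - ?g u u = 0" "?f v v - ?g v v = 0" "?f u v - ?g u v = - s" "?f v u - ?g v u = - s"
      using uv(3) adj_le_1[of u v] adj_sym[of v u]
      by (auto simp: flip_def doubleton_eq_iff s_def c_def of_nat_diff algebra_simps insert_commute)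
    have "char_det (flip G u v) = det (list_mat ([u,v] @ zs) ([u,v] @ zs) ?f)"
      unfolding char_det_def using det_resolvent_adj_mat[OF xs] by (simp add: flip_def)
    also have "\<dots> = \<delta> * (schur N' zs ?f u u * schur N' zs ?f v v - schur N' zs ?f u v * schur N' zs ?f v u)"
      using det_list_mat_append[of N' zs ?f "[u,v]"] N' unfolding inner det_list_mat_2 \<delta>_def by simp
    also have "\<dots> = \<delta> * (S u u * S v v - (S u v - s) * (S v u - s))"
      using Sf[of u u] Sf[of v v] Sf[of u v] Sf[of v u] d by simp
    also have "\<dots> = \<phi> + s * (\<delta> * S u v) + s * (\<delta> * S v u) - s\<^sup>2 * \<delta>"
      unfolding phi by (simp add: algebra_simps power2_eq_square)
    also have "\<dots> = \<phi> * (1 - 2 * s * t - s\<^sup>2 * (r\<^sup>2 - t\<^sup>2))"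
      unfolding \<delta>(3,4) by (subst \<delta>(1)) (simp add: algebra_simps)
    finally show ?thesis by (simp add: s_def power_mult_distrib mult.assoc)
  qed
  show "char_det (amalgamate G u v) = \<phi> * (2 * r - 2 * t - (1 - fps_X * c) * (r\<^sup>2 - t\<^sup>2))"
  proof -
    let ?f = "resolvent_entry (snd (amalgamate G u v))"
    let ?zs = "map Some zs"
    have xs': "distinct ([None] @ ?zs)" "set ([None] @ ?zs) = fst (amalgamate G u v)"
      using zs by (auto simp: distinct_map amalgamate_def)
    have inner: "list_mat ?zs ?zs ?f = list_mat zs zs ?g"
      unfolding list_mat_map by (rule list_mat_cong) (auto simp: amalgamate_def)
    have z: "zs ! i \<noteq> u" "zs ! i \<noteq> v" if "i < length zs" for i
      using zs(1) nth_mem[OF that] by auto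
    \<comment> \<open>The couplings of the amalgamated vertex are the sums of those of u and v, so
      the correction term expands into the four forms occurring in S.\<close>
    have "schur N' ?zs ?f None None = 1 - fps_X * c -
        bilin N' (\<lambda>i. ?g u (zs ! i) + ?g v (zs ! i)) (\<lambda>i. ?g (zs ! i) u + ?g (zs ! i) v)"
    proof -
      have "bilin N' (\<lambda>i. ?f None (?zs ! i)) (\<lambda>i. ?f (?zs ! i) None) =
          bilin N' (\<lambda>i. ?g u (zs ! i) + ?g v (zs ! i)) (\<lambda>i. ?g (zs ! i) u + ?g (zs ! i) v)"
        using z by (intro bilin_cong[OF N'(1)])
          (auto simp: amalgamate_def algebra_simps adj_sym[of u] adj_sym[of v] dest: not_sym)
      then show ?thesis by (simp add: schur_def c_def amalgamate_def)
    qed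
    \<comment> \<open>The four entries of S carry 2 - 2Xc in front of their forms, while the new
      diagonal entry is only 1 - Xc; the surplus 1 - Xc is subtracted.\<close>
    also have "\<dots> = S u u + S v v + S u v + S v u - 1 + fps_X * c"
      unfolding bilin_add S_def schur_def c_def
      using uv(3) adj_sym[of v u] by (simp add: adj_self)
    finally have Snone: "schur N' ?zs ?f None None = S u u + S v v + S u v + S v u - 1 + fps_X * c" .
    have "char_det (amalgamate G u v) = det (list_mat ([None] @ ?zs) ([None] @ ?zs) ?f)"
      unfolding char_det_def using det_resolvent_adj_mat[OF xs'] by (metis prod.collapse)
    also have "\<dots> = \<delta> * schur N' ?zs ?f None None"
      using det_list_mat_append[of N' ?zs ?f "[None]"] N' unfolding inner det_list_mat_1 \<delta>_def by simp
    also have "\<dots> = \<delta> * S u u + \<delta> * S v v + \<delta> * S u v + \<delta> * S v u - (1 - fps_X * c) * \<delta>"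
      unfolding Snone by (simp add: algebra_simps)
    also have "\<dots> = \<phi> * (2 * r - 2 * t - (1 - fps_X * c) * (r\<^sup>2 - t\<^sup>2))"
      unfolding \<delta>(2-5) by (subst \<delta>(1)) (simp add: algebra_simps)
    finally show ?thesis .
  qed
  show "char_det (add_path G u v) = \<phi> * (1 - 2 * fps_X\<^sup>2 * (r + t))"
  proof -
    let ?f = "resolvent_entry (snd (add_path G u v))"
    let ?zs = "map Some zs"
    let ?ys = "[Some u, Some v] @ [None]"
    have xs': "distinct (?ys @ ?zs)" "set (?ys @ ?zs) = fst (add_path G u v)"
      using zs uv by (auto simp: distinct_map add_path_def)
    have inner: "list_mat ?zs ?zs ?f = list_mat zs zs ?g"
      unfolding list_mat_map by (rule list_mat_cong) (auto simp: add_path_def)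
    have z: "zs ! i \<noteq> u" "zs ! i \<noteq> v" if "i < length zs" for i
      using zs(1) nth_mem[OF that] by auto
    let ?S = "schur N' ?zs ?f"
    have SS: "?S (Some x) (Some y) = S x y" for x y
      by (simp add: S_def schur_def add_path_def cong: bilin_cong[OF N'(1)])
    \<comment> \<open>The new vertex has no neighbour in \<open>zs\<close>, so eliminating
      \<open>zs\<close> leaves its row and column as they are.\<close>
    have SN: "?S None y = ?f None y" "?S y None = ?f y None" for y
    proof -
      have "bilin N' (\<lambda>i. ?f None (?zs ! i)) b = bilin N' (\<lambda>i. 0) b" for b
        using z by (intro bilin_cong[OF N'(1)]) (auto simp: add_path_def)
      moreover have "bilin N' b (\<lambda>i. ?f (?zs ! i) None) = bilin N' b (\<lambda>i. 0)" for b
        using z by (intro bilin_cong[OF N'(1)]) (auto simp: add_path_def)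
      ultimately show "?S None y = ?f None y" "?S y None = ?f y None"
        by (simp_all add: schur_def bilin_0)
    qed
    have f: "?f None None = 1" "?f None (Some u) = - fps_X" "?f None (Some v) = - fps_X"
        "?f (Some u) None = - fps_X" "?f (Some v) None = - fps_X"
      by (simp_all add: add_path_def)
    \<comment> \<open>A second Schur complement, now with respect to the new vertex, reduces 3 x 3 to 2 x 2.\<close>
    have one: "list_mat [None] [None] ?S = 1\<^sub>m 1"
    proof (rule eq_matI)
      have "?S None None = 1" unfolding SN f ..
      then show "list_mat [None] [None] ?S $$ (i,j) = 1\<^sub>m 1 $$ (i,j)"
        if "i < dim_row (1\<^sub>m 1 :: real fps mat)" "j < dim_col (1\<^sub>m 1 :: real fps mat)" for i j
        using that by (simp add: list_mat_def)
    qed simp_all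
    \<comment> \<open>With 1 as the pivot and -X as each coupling, this elimination subtracts X^2
      from all four entries of S.\<close>
    have SO: "schur (1\<^sub>m 1) [None] ?S x y = ?S x y - ?S x None * ?S None y" for x y
      by (simp add: schur_def bilin_def)
    have "char_det (add_path G u v) = det (list_mat (?ys @ ?zs) (?ys @ ?zs) ?f)"
      unfolding char_det_def using det_resolvent_adj_mat[OF xs'] by (metis prod.collapse)
    also have "\<dots> = \<delta> * det (list_mat ?ys ?ys ?S)"
      using det_list_mat_append[of N' ?zs ?f ?ys] N' unfolding inner \<delta>_def by simp
    also have "det (list_mat ?ys ?ys ?S) = (S u u - fps_X\<^sup>2) * (S v v - fps_X\<^sup>2) - (S u v - fps_X\<^sup>2) * (S v u - fps_X\<^sup>2)"
      using det_list_mat_append[of "1\<^sub>m 1" "[None]" ?S "[Some u, Some v]"]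
      unfolding one det_list_mat_2 SO SS SN f by (simp add: power2_eq_square)
    \<comment> \<open>Subtracting one quantity from all four entries changes a 2 x 2 determinant
      linearly: the squares of that quantity cancel.\<close>
    also have "\<delta> * \<dots> = \<phi> - fps_X\<^sup>2 * (\<delta> * S u u + \<delta> * S v v - \<delta> * S u v - \<delta> * S v u)"
      unfolding phi by (simp add: algebra_simps)
    also have "\<dots> = \<phi> * (1 - 2 * fps_X\<^sup>2 * (r + t))"
      unfolding \<delta>(2-5) by (simp add: algebra_simps)
    finally show ?thesis .
  qed
qed

section \<open>From spectra back to walk series\<close>

lemma sp_flip_iff:
  assumes "u \<in> V" "v \<in> V" "w \<in> V" "z \<in> V"
  shows "sp (flip G u v) = sp (flip G w z) \<longleftrightarrow> char_det (flip G u v) = char_det (flip G w z)"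
  unfolding char_det_def flip_def
  by (rule sp_eq_iff[OF finV finV refl]) (use adj_sym in \<open>auto simp: insert_commute\<close>)

text \<open>Distinctness gives both amalgamated graphs one vertex less than G, hence matrices of the
  same size.\<close>

lemma sp_amalgamate_iff:
  assumes "u \<in> V" "v \<in> V" "w \<in> V" "z \<in> V" "u \<noteq> v" "w \<noteq> z"
  shows "sp (amalgamate G u v) = sp (amalgamate G w z) \<longleftrightarrow>
    char_det (amalgamate G u v) = char_det (amalgamate G w z)"
proof -
  have card: "card (insert None (Some ` (V - {x,y}))) = card V - 1" if "x \<in> V" "y \<in> V" "x \<noteq> y" for x y
  proof -
    have "card {x,y} \<le> card V" using that finV by (intro card_mono) auto
    then show ?thesis
      using that finV by (simp add: card_insert_if card_image card_Diff_subset)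
  qed
  show ?thesis
    unfolding char_det_def amalgamate_def
    by (rule sp_eq_iff) (use finV adj_sym card assms in \<open>auto split: option.splits\<close>)
qed

lemma sp_add_path_iff:
  assumes "u \<in> V" "v \<in> V" "w \<in> V" "z \<in> V"
  shows "sp (add_path G u v) = sp (add_path G w z) \<longleftrightarrow>
    char_det (add_path G u v) = char_det (add_path G w z)"
  unfolding char_det_def add_path_def
  by (rule sp_eq_iff) (use finV adj_sym in \<open>auto split: option.splits\<close>)

text \<open>The determinant of the looped graph involves u only through \<open>T u u\<close>, which
  walk-regularity makes constant. This settles isospectrality for h = 0.\<close>

lemma sp_flip_loop_eq:
  assumes "u \<in> V" "w \<in> V"
  shows "sp (flip G u u) = sp (flip G w w)"
  unfolding sp_flip_iff[OF assms(1,1,2,2)] char_det_loop[OF assms(1)] char_det_loop[OF assms(2)]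
    T_diag[OF assms] ..

text \<open>In each case the difference of the two determinants factors as T u v - T w z times a series
  which is nonzero because of its constant or lowest coefficient.\<close>
lemma isospectral_iff_T_eq:
  assumes uv: "u \<in> V" "v \<in> V" "u \<noteq> v" and wz: "w \<in> V" "z \<in> V" "w \<noteq> z"
    and adj: "adj G u v = adj G w z"
  shows "(sp (flip G u v) = sp (flip G w z) \<or>
    sp (amalgamate G u v) = sp (amalgamate G w z) \<or>
    sp (add_path G u v) = sp (add_path G w z)) \<longleftrightarrow> T u v = T w z"
proof
  assume "T u v = T w z"
  then have "char_det (flip G u v) = char_det (flip G w z)"
    unfolding char_det_pair(1)[OF uv] char_det_pair(1)[OF wz] adj T_diag[OF uv(1) wz(1)] by simp
  then show "sp (flip G u v) = sp (flip G w z) \<or>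
    sp (amalgamate G u v) = sp (amalgamate G w z) \<or>
    sp (add_path G u v) = sp (add_path G w z)" using sp_flip_iff uv wz by simp
next
  define r where "r = T u u"
  define t where "t = T u v"
  define t' where "t' = T w z"
  define c where "c = (of_nat (adj G u v) :: real fps)"
  have r': "T w w = r" unfolding r_def by (rule T_diag[OF wz(1) uv(1)])
  \<comment> \<open>Vanishing constant terms leave the cofactor of t - t' with constant term 2 in
    the amalgamation case; for flipping, the factor X already does this.\<close>
  have t0: "fps_nth t 0 = 0" "fps_nth t' 0 = 0"
    using T_nth_0 uv wz unfolding t_def t'_def by auto
  have cancel: "x = y" if "\<phi> * x = \<phi> * y" for x y using that \<phi>_nonzero by simp
  have nz: "f \<noteq> 0" if "fps_nth f 0 \<noteq> 0" for f :: "real fps" using that by auto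
  assume "sp (flip G u v) = sp (flip G w z) \<or>
    sp (amalgamate G u v) = sp (amalgamate G w z) \<or>
    sp (add_path G u v) = sp (add_path G w z)"
  then consider "char_det (flip G u v) = char_det (flip G w z)"
    | "char_det (amalgamate G u v) = char_det (amalgamate G w z)"
    | "char_det (add_path G u v) = char_det (add_path G w z)"
    using sp_flip_iff sp_amalgamate_iff sp_add_path_iff uv wz by metis
  then have "t = t'"
  proof cases
    case 1
    let ?s = "1 - 2 * c"
    have "1 - 2 * ?s * fps_X * t - ?s\<^sup>2 * fps_X\<^sup>2 * (r\<^sup>2 - t\<^sup>2)
        = 1 - 2 * ?s * fps_X * t' - ?s\<^sup>2 * fps_X\<^sup>2 * (r\<^sup>2 - t'\<^sup>2)"
      using cancel 1 unfolding char_det_pair(1)[OF uv] char_det_pair(1)[OF wz]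
        adj[symmetric] r' r_def[symmetric] t_def[symmetric] t'_def[symmetric] c_def[symmetric] by blast
    then have "(t - t') * (?s * (fps_X * (2 - ?s * (fps_X * (t + t'))))) = 0"
      by (simp add: algebra_simps power2_eq_square)
    moreover have "2 - ?s * (fps_X * (t + t')) \<noteq> 0" by (rule nz) simp
    moreover have "?s \<noteq> 0"
    proof (rule nz)
      have "fps_nth ?s 0 = 1 - 2 * real (adj G u v)" by (simp add: c_def fps_numeral_nth fps_of_nat[symmetric])
      then show "fps_nth ?s 0 \<noteq> 0" by (simp add: adj_def)
    qed
    ultimately show ?thesis by simp
  next
    case 2
    have "2 * r - 2 * t - (1 - fps_X * c) * (r\<^sup>2 - t\<^sup>2) = 2 * r - 2 * t' - (1 - fps_X * c) * (r\<^sup>2 - t'\<^sup>2)"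
      using cancel 2 unfolding char_det_pair(2)[OF uv] char_det_pair(2)[OF wz]
        adj[symmetric] r' r_def[symmetric] t_def[symmetric] t'_def[symmetric] c_def[symmetric] by blast
    then have "(t - t') * (2 - (1 - fps_X * c) * (t + t')) = 0"
      by (simp add: algebra_simps power2_eq_square)
    moreover have "2 - (1 - fps_X * c) * (t + t') \<noteq> 0" by (rule nz) (simp add: t0)
    ultimately show ?thesis by simp
  next
    case 3
    have "1 - 2 * fps_X\<^sup>2 * (r + t) = 1 - 2 * fps_X\<^sup>2 * (r + t')"
      using cancel 3 unfolding char_det_pair(3)[OF uv] char_det_pair(3)[OF wz]
        r' r_def[symmetric] t_def[symmetric] t'_def[symmetric] by blast
    then show ?thesis by simp
  qed
  then show "T u v = T w z" unfolding t_def t'_def .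
qed

lemma T_eq_iff_eigenproj_eq:
  assumes "x \<in> V" "y \<in> V" "x' \<in> V" "y' \<in> V"
  shows "T x y = T x' y' \<longleftrightarrow> (\<forall>s\<in>spectrum (gmat G).
    entry V (eigenproj (gmat G) s) x y = entry V (eigenproj (gmat G) s) x' y')"
proof -
  obtain P Q d where "P \<in> carrier_mat (card V) (card V)" "Q \<in> carrier_mat (card V) (card V)"
    "P * Q = 1\<^sub>m (card V)" "Q * P = 1\<^sub>m (card V)"
    "\<And>i k. i < card V \<Longrightarrow> k < card V \<Longrightarrow> (gmat G * P) $$ (i,k) = d k * P $$ (i,k)"
    using symmetric_real_diagonalizable[OF gmat_carrier transpose_gmat] by blast
  then interpret diagonalized "card V" "gmat G" P Q d
    using gmat_carrier transpose_gmat by unfold_locales auto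
  show ?thesis
    unfolding T_eq_iff entry_def
    by (rule pow_entries_eq_iff_eigenproj_entries_eq) (use idx_less assms in auto)
qed

lemma punctually_walk_regular_iff_spectrum_regular:
  "punctually_walk_regular h G \<longleftrightarrow> punctually_spectrum_regular h G"
proof -
  have "punctually_walk_regular h G \<longleftrightarrow> (\<forall>u\<in>V. \<forall>v\<in>V. \<forall>w\<in>V. \<forall>z\<in>V.
      gdist G u v = ereal (real h) \<longrightarrow> gdist G w z = ereal (real h) \<longrightarrow> T u v = T w z)"
    unfolding punctually_walk_regular_def T_eq_iff by blast
  also have "\<dots> \<longleftrightarrow> punctually_spectrum_regular h G"
    unfolding punctually_spectrum_regular_def using T_eq_iff_eigenproj_eq by blast
  finally show ?thesis .
qed

text \<open>For h = 0 both properties follow from walk-regularity. For positive h the vertices at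
  distance h are distinct and their adjacency depends on h alone, so
  \<open>isospectral_iff_T_eq\<close> applies pair by pair, whichever of the three alternatives
  holds there.\<close>

lemma punctually_walk_regular_iff_isospectral:
  "punctually_walk_regular h G \<longleftrightarrow> punctually_isospectral h G"
proof (cases "h = 0")
  case True
  have "u = v" if "gdist G u v = ereal (real h)" for u v
    using gdist_ge_1[OF G, of u v] that True by (cases "u = v") auto
  then have "punctually_walk_regular h G"
    using wr unfolding punctually_walk_regular_def walk_regular_def by metis
  moreover have "punctually_isospectral h G"
    unfolding punctually_isospectral_def using sp_flip_loop_eq by (simp only: True refl if_True) blast
  ultimately show ?thesis by simp
next
  case False
  have ne: "u \<noteq> v" if "u \<in> V" "gdist G u v = ereal (real h)" for u v
  proof
    assume "u = v"
    interpret pair_graph G by (rule G)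
    have "awalk u [] u" using that(1) by (simp add: awalk_def)
    then have "gdist G u u \<le> 0"
      using min_cost_le_walk_cost[of u "[]" u "\<lambda>_. 1"] by (simp add: gdist_def zero_ereal_def)
    then show False using that(2) \<open>u = v\<close> False by simp
  qed
  have adj: "adj G u v = of_bool (h = 1)" if "u \<in> V" "gdist G u v = ereal (real h)" for u v
    using gdist_adj[OF G that(1) ne[OF that]] that(2) by (auto simp: adj_def one_ereal_def)
  have "punctually_walk_regular h G \<longleftrightarrow> (\<forall>u\<in>V. \<forall>v\<in>V. \<forall>w\<in>V. \<forall>z\<in>V.
      gdist G u v = ereal (real h) \<longrightarrow> gdist G w z = ereal (real h) \<longrightarrow> T u v = T w z)"
    unfolding punctually_walk_regular_def T_eq_iff by blast
  also have "\<dots> \<longleftrightarrow> punctually_isospectral h G"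
    using isospectral_iff_T_eq ne adj False unfolding punctually_isospectral_def
    by (simp add: Ball_def)
  finally show ?thesis .
qed

end

theorem corollary4p4:
  fixes G :: "'a pair_pre_digraph" and D h :: nat
  assumes "pair_graph G"
    and "connected (with_proj G)"
    and "walk_regular G"
    and "diameter G = ereal (real D)"
    and "h \<le> D"
  shows "(punctually_walk_regular h G \<longleftrightarrow> punctually_spectrum_regular h G) \<and>
         (punctually_spectrum_regular h G \<longleftrightarrow> punctually_isospectral h G)"
proof -
  interpret walk_regular_pair_graph G by (rule walk_regular_pair_graph.intro[OF assms(1,3)])
  show ?thesis using punctually_walk_regular_iff_spectrum_regular punctually_walk_regular_iff_isospectral by blast
qed

end
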